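(* Let $G=\mathrm{GL}_3$ and let $$\gamma=\begin{bmatrix}0&b_0\epsilon^{n_1}&c_0\epsilon^{n_2}\\ c_0\epsilon^{n_2+1}&0&b_0\epsilon^{n_1}\\ b_0\epsilon^{n_1+1}&c_0\epsilon^{n_2+1}&0\end{bmatrix},\qquad b_0,c_0\in\mathcal O^\times,\ n_1,n_2\in\mathbf N.$$ Suppose $n_1\le n_2$ (so that $\gamma$ is equivalued of valuation $n_1+\frac13$). Then \begin{align*} I_\gamma^G=|\mathcal X_\gamma^0(\mathbf F_q)|=\ &1+2\sum_{i=1}^{\lfloor n_1/3\rfloor}q^{2(3i-1)}(q^2+q+1)\\ &+\sum_{i=1}^{n_1}\Big(i-2\Big\lfloor\frac i3\Big\rfloor-1\Big)q^{2i-3}(q^3+2q^2+2q+1)\\ &+\sum_{i=n_1+1}^{2n_1}\Big(2n_1-i-2\Big\lceil\frac{2n_1-i}{3}\Big\rceil+1\Big)q^{i+n_1-1}(q+2)\\ &+q^{2n_1-1}\Big(\Big\lceil\frac{2n_1-1}{3}\Big\rceil-\Big\lfloor\frac{n_1-2}{3}\Big\rfloor-1\Big)+2\sum_{i=\lceil(2n_1-1)/3\rceil}^{n_1-1}q^{3i+1}. \end{align*}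
   Context: $F=\mathbf F_q((\epsilon))$, $\mathcal O=\mathbf F_q[[\epsilon]]$, $\mathrm{char}(\mathbf F_q)>3$, $K=G(\mathcal O)$; $\mathfrak g$ is the Lie algebra of $G$. $\lfloor x\rfloor$ (resp. $\lceil x\rceil$) is the largest integer $\le x$ (resp. smallest integer $\ge x$). Sums whose lower index exceeds the upper index are zero. The centralizer $T$ of $\gamma$ satisfies $T(F)\cong E_3^\times$ with $E_3=\mathbf F_q((\epsilon^{1/3}))$. $\mathcal X_\gamma=\{[g]\in G(F)/K:\mathrm{Ad}(g^{-1})\gamma\in\mathfrak g(\mathcal O)\}$ is the affine Springer fiber and $\mathcal X_\gamma^0=\{[g]\in\mathcal X_\gamma:\mathrm{val}(\det g)=0\}$. The orbital integral is $$I_\gamma^G=\int_{T(F)\backslash G(F)}\mathbf 1_{\mathfrak g(\mathcal O)}(\mathrm{Ad}(g^{-1})\gamma)\,\frac{dg}{dt}$$ with Haar measures normalized by $\mathrm{vol}(K)=1$ and $\mathrm{vol}(\mathcal O_{E_3}^\times)=1$. *)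

theory Defs
  imports
    "HOL-Analysis.Analysis"
    "HOL-Algebra.Coset"
    "HOL-Computational_Algebra.Formal_Laurent_Series"
begin

text \<open>
  The ring \<open>\<O>\<close> is \<^typ>\<open>'k fps\<close> and its fraction field \<open>F\<close> is \<^typ>\<open>'k fls\<close>, with \<open>\<O>\<close> embedded
  by \<^const>\<open>fps_to_fls\<close>. The library metric on \<^typ>\<open>'k fls\<close> induces the valuation topology, so
  matrices over \<open>F\<close> carry the usual topology of \<open>F\<^bsup>n \<times> n\<^esup>\<close>, and \<open>GL\<^sub>n(F)\<close> and its subgroups the
  subspace topology.
\<close>

definition GL :: "('a::field ^'n^'n) monoid" where
  "GL = \<lparr>carrier = {A. invertible A}, mult = (**), one = mat 1\<rparr>"

definition GL_O :: "('k::field fls ^'n^'n) set" where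
  "GL_O = map_matrix fps_to_fls ` {A. invertible A}"

definition gl_O :: "('k::field fls ^'n^'n) set" where
  "gl_O = range (map_matrix fps_to_fls)"

definition Ad :: "'a::field ^'n^'n \<Rightarrow> 'a ^'n^'n \<Rightarrow> 'a ^'n^'n" where
  "Ad g X = g ** X ** matrix_inv g"

definition centralizer :: "'a::field ^'n^'n \<Rightarrow> ('a ^'n^'n) set" where
  "centralizer \<gamma> = {t \<in> carrier GL. t ** \<gamma> = \<gamma> ** t}"

definition springer_fiber :: "'k::field fls ^'n^'n \<Rightarrow> ('k fls ^'n^'n) set set" where
  "springer_fiber \<gamma> =
     {g <#\<^bsub>GL\<^esub> GL_O | g. g \<in> carrier GL \<and> Ad (matrix_inv g) \<gamma> \<in> gl_O}"

definition springer_fiber0 :: "'k::field fls ^'n^'n \<Rightarrow> ('k fls ^'n^'n) set set" where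
  "springer_fiber0 \<gamma> =
     {g <#\<^bsub>GL\<^esub> GL_O | g. g \<in> carrier GL \<and> g <#\<^bsub>GL\<^esub> GL_O \<in> springer_fiber \<gamma> \<and>
        fls_subdegree (det g) = 0}"

text \<open>
  The field \<open>E\<^sub>3 = k((\<epsilon>\<^bsup>1/3\<^esup>))\<close> is a second copy of \<^typ>\<open>'k fls\<close>, in the variable
  \<open>s = \<epsilon>\<^bsup>1/3\<^esup>\<close>; the field \<open>F\<close> embeds into it by \<open>f(\<epsilon>) \<mapsto> f(s\<^sup>3)\<close>. The following map is the
  \<open>F\<close>-linear isomorphism from \<open>F\<^sup>3\<close> onto \<open>E\<^sub>3\<close> sending the standard basis to \<open>s\<^sup>2, s, 1\<close>.
\<close>

definition E3_of_vec :: "'k::field fls ^3 \<Rightarrow> 'k fls" where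
  "E3_of_vec v = fls_compose_power (v $ 1) 3 * fls_X ^ 2 + fls_compose_power (v $ 2) 3 * fls_X
     + fls_compose_power (v $ 3) 3"

text \<open>
  \<open>E\<^sub>3\<^sup>\<times>\<close> acts on \<open>F\<^sup>3\<close> by multiplication through \<^const>\<open>E3_of_vec\<close>; this is the
  identification of \<open>E\<^sub>3\<^sup>\<times>\<close> with the centralizer of \<open>\<gamma>\<close>, by the lemma below. The next set is the
  image of \<open>\<O>\<^bsub>E\<^sub>3\<^esub>\<^sup>\<times>\<close>. It does not depend on the chosen identification: two of them
  differ by an \<open>F\<close>-automorphism of \<open>E\<^sub>3\<close>, which preserves the valuation.
\<close>

definition E3_units :: "('k::field fls ^3^3) set" where
  "E3_units = {A. \<exists>u :: 'k fps. u dvd 1 \<and>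
     (\<forall>v. E3_of_vec (A *v v) = fps_to_fls u * E3_of_vec v)}"

lemma E3_of_vec_gamma:
  fixes b c :: "'k::field fls"
  shows "E3_of_vec ((vector [vector [0, b, c],
                             vector [c * fls_X, 0, b],
                             vector [b * fls_X, c * fls_X, 0]] :: 'k fls ^3^3) *v v) =
         (fls_compose_power b 3 * fls_X + fls_compose_power c 3 * fls_X ^ 2) * E3_of_vec v"
proof -
  have X: "fls_X_intpow 3 = (fls_X :: 'k fls) ^ 3"
    by (simp add: fls_X_power_conv_shift_1)
  show ?thesis
    by (simp add: E3_of_vec_def matrix_vector_mult_def sum_3 vector_3 X algebra_simps
        power2_eq_square power3_eq_cube)
qed

text \<open>
  Left Haar measures on a group with locally compact, second countable Hausdorff topology, on
  the Borel sets of the subspace topology. Regularity is automatic for such groups.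
\<close>

definition haar_measure :: "('a::topological_space, 'b) monoid_scheme \<Rightarrow> 'a measure \<Rightarrow> bool" where
  "haar_measure G M \<longleftrightarrow>
     sets M = sets (restrict_space borel (carrier G)) \<and>
     (\<forall>x \<in> carrier G. \<forall>A \<in> sets M. emeasure M (x <#\<^bsub>G\<^esub> A) = emeasure M A) \<and>
     (\<forall>C. C \<subseteq> carrier G \<and> compact C \<longrightarrow> emeasure M C < \<infinity>) \<and>
     (\<forall>U. openin (top_of_set (carrier G)) U \<and> U \<noteq> {} \<longrightarrow> 0 < emeasure M U)"

text \<open>
  The quotient measure \<open>dg/dt\<close> on \<open>T\G\<close>, the set of cosets \<open>Tg\<close> with the quotient
  sigma-algebra, is characterised by Weil's formula
  \<open>\<integral>\<^bsub>G\<^esub> f(g) dg = \<integral>\<^bsub>T\G\<^esub> (\<integral>\<^bsub>T\<^esub> f(tg) dt) dg/dt\<close>.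
  The inner integral, as a function of \<open>g\<close>, is constant on the cosets \<open>Tg\<close> when \<open>dt\<close> is right
  invariant; \<open>the_elem (h ` C)\<close> is the value on \<open>C\<close> of a function \<open>h\<close> that is constant on cosets.
\<close>

definition quotient_measure ::
  "('a, 'b) monoid_scheme \<Rightarrow> 'a set \<Rightarrow> 'a measure \<Rightarrow> 'a measure \<Rightarrow> 'a set measure \<Rightarrow> bool" where
  "quotient_measure G T dg dt dm \<longleftrightarrow>
     space dm = rcosets\<^bsub>G\<^esub> T \<and>
     sets dm = {S. S \<subseteq> rcosets\<^bsub>G\<^esub> T \<and> \<Union>S \<in> sets dg} \<and>
     (\<forall>f :: 'a \<Rightarrow> ennreal. f \<in> borel_measurable dg \<longrightarrow>
        (\<integral>\<^sup>+ g. f g \<partial>dg) =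
        (\<integral>\<^sup>+ C. the_elem ((\<lambda>g. \<integral>\<^sup>+ t. f (t \<otimes>\<^bsub>G\<^esub> g) \<partial>dt) ` C) \<partial>dm))"

definition orbital_integral :: "('k::field fls ^'n^'n) set measure \<Rightarrow> 'k fls ^'n^'n \<Rightarrow> real" where
  "orbital_integral dm \<gamma> =
     (\<integral>C. the_elem ((\<lambda>g. indicator gl_O (Ad (matrix_inv g) \<gamma>)) ` C) \<partial>dm)"

end

theory Submission
  imports Defs
begin

text \<open>
  Identify \<open>F\<^sup>3\<close> with \<open>E\<^sub>3 = k((s))\<close>, \<open>s\<^sup>3 = \<epsilon>\<close>, so that \<open>\<gamma>\<close> becomes multiplication by
  \<open>\<epsilon>\<^sup>n (b s + c s\<^sup>2)\<close> with \<open>n = n\<^sub>1\<close>, \<open>b = b\<^sub>0\<close>, \<open>c = c\<^sub>0 \<epsilon>^(n\<^sub>2 - n\<^sub>1)\<close>. The points of the affine Springer fiber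
  are the \<open>\<gamma>\<close>-stable lattices in \<open>E\<^sub>3\<close>. The valuations of the elements of a lattice have a
  minimum in every residue class modulo 3; after multiplication by a power of \<open>s\<close>, which
  centralizes \<open>\<gamma>\<close>, the smallest of the three minima is 0 and the other two are
  \<open>3 i + 1, 3 (i + j) + 2\<close> or \<open>3 i + 2, 3 (i + j + 1) + 1\<close>. Elements of these valuations form
  a basis, which has a unique reduced form with three truncated series \<open>x, y, z\<close> as parameters.
  In the second case the lattice is stable iff \<open>i + j < n\<close>. In the first case it is stable iff
  \<open>i, j \<le> n\<close> and one congruence modulo \<open>\<epsilon>^(i + j - n)\<close> holds, which for given \<open>y, z\<close> is of the form
  \<open>b x = \<dots> + \<epsilon> \<dots>\<close> and so determines the lowest coefficients of \<open>x\<close>. Hence the number of points is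
  the sum of \<open>q^min(2 (i + j), i + j + n)\<close> over \<open>i, j \<le> n\<close> plus the sum of \<open>q^(2 (i + j) + 1)\<close> over
  \<open>i + j < n\<close>. The orbital integral is computed by Weil's formula for the indicator function of
  \<open>{g. Ad(g\<^bsup>-1\<^esup>)\<gamma> integral, val (det g) = 0}\<close>, whose intersection with each coset \<open>Tg\<close>
  on which the integrand is 1 is a translate of \<open>\<O>\<^bsub>E\<^sub>3\<^esub>\<^sup>\<times>\<close>.
\<close>

section \<open>Truncated power series\<close>

lemma fps_X_power_dvd_iff:
  fixes f :: "'a::field fps"
  shows "fps_X ^ m dvd f \<longleftrightarrow> (\<forall>i<m. f $ i = 0)"
proof
  assume "fps_X ^ m dvd f"
  then show "\<forall>i<m. f $ i = 0"
    by (auto elim!: dvdE simp: fps_X_power_mult_nth)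
next
  assume "\<forall>i<m. f $ i = 0"
  then have "f = fps_X ^ m * fps_shift m f"
    by (auto simp: fps_eq_iff fps_X_power_mult_nth)
  then show "fps_X ^ m dvd f" by (rule dvdI)
qed

text \<open>Canonical representatives of the residue classes modulo \<open>fps_X ^ m\<close>; the
  parameters of a reduced lattice are taken from such sets.\<close>

definition fps_trunc :: "nat \<Rightarrow> 'a::zero fps set" where
  "fps_trunc m = {f. \<forall>i\<ge>m. f $ i = 0}"

lemma fps_cutoff_in_trunc: "fps_cutoff m f \<in> fps_trunc m"
  by (simp add: fps_trunc_def)

lemma dvd_diff_cutoff:
  fixes f :: "'a::field fps"
  shows "fps_X ^ m dvd f - fps_cutoff m f"
  by (simp add: fps_X_power_dvd_iff)

lemma fps_trunc_eqI:
  fixes f :: "'a::field fps"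
  assumes "f \<in> fps_trunc m" "g \<in> fps_trunc m" "fps_X ^ m dvd f - g"
  shows "f = g"
proof (rule fps_ext)
  fix i show "f $ i = g $ i"
    using assms by (cases "i < m") (auto simp: fps_trunc_def fps_X_power_dvd_iff)
qed

lemma card_fps_trunc_dvd:
  assumes "d \<le> m"
  shows "finite {f \<in> fps_trunc m. fps_X ^ d dvd (f :: 'a::{field,finite} fps)}"
    and "card {f \<in> fps_trunc m. fps_X ^ d dvd (f :: 'a fps)} = CARD('a) ^ (m - d)"
proof -
  let ?S = "{f \<in> fps_trunc m. fps_X ^ d dvd (f :: 'a fps)}"
  let ?P = "PiE {d..<m} (\<lambda>_. UNIV :: 'a set)"
  have "bij_betw (\<lambda>f. restrict (fps_nth f) {d..<m}) ?S ?P"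
  proof (rule bij_betw_byWitness[where f' = "\<lambda>h. Abs_fps (\<lambda>i. if d \<le> i \<and> i < m then h i else 0)"])
    show "\<forall>f\<in>?S. Abs_fps (\<lambda>i. if d \<le> i \<and> i < m then restrict (fps_nth f) {d..<m} i else 0) = f"
      by (auto simp: fps_eq_iff fps_trunc_def fps_X_power_dvd_iff)
    show "\<forall>h\<in>?P. restrict (fps_nth (Abs_fps (\<lambda>i. if d \<le> i \<and> i < m then h i else 0))) {d..<m} = h"
      by (auto simp: fun_eq_iff PiE_def extensional_def)
  qed (auto simp: fps_trunc_def fps_X_power_dvd_iff)
  note bij = this
  show "finite ?S"
    using bij_betw_finite[OF bij] by (simp add: finite_PiE)
  show "card ?S = CARD('a) ^ (m - d)"
    using bij_betw_same_card[OF bij] by (simp add: card_PiE)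
qed

lemma card_fps_trunc:
  shows "finite (fps_trunc m :: 'a::{field,finite} fps set)"
    and "card (fps_trunc m :: 'a fps set) = CARD('a) ^ m"
  using card_fps_trunc_dvd[of 0 m, where 'a = 'a] by auto

text \<open>The map \<open>x \<mapsto> \<psi>(x) mod X\<^bsup>m\<^esup>\<close> is injective, hence a permutation of the truncated series.\<close>

lemma card_fps_trunc_dvd_bij:
  fixes \<psi> :: "'a::{field,finite} fps \<Rightarrow> 'a fps"
  assumes "d \<le> m" and \<psi>: "\<And>x y. \<exists>u. u dvd 1 \<and> \<psi> x - \<psi> y = (x - y) * u"
  shows "card {f \<in> fps_trunc m. fps_X ^ d dvd \<psi> f} = CARD('a) ^ (m - d)"
proof -
  let ?T = "fps_trunc m :: 'a fps set"
  let ?\<phi> = "\<lambda>x. fps_cutoff m (\<psi> x)"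
  have inj: "inj_on ?\<phi> ?T"
  proof (rule inj_onI)
    fix x y assume xy: "x \<in> ?T" "y \<in> ?T" "?\<phi> x = ?\<phi> y"
    obtain u where u: "u dvd 1" "\<psi> x - \<psi> y = (x - y) * u" using \<psi> by blast
    have "fps_X ^ m dvd (\<psi> x - ?\<phi> x) - (\<psi> y - ?\<phi> y)"
      by (intro dvd_diff dvd_diff_cutoff)
    then have "fps_X ^ m dvd (x - y) * u" using xy(3) u(2) by simp
    then have "fps_X ^ m dvd x - y" using u(1) by (simp add: dvd_mult_unit_iff)
    then show "x = y" using xy(1,2) by (rule fps_trunc_eqI[rotated 2])
  qed
  \<comment> \<open>An injective self-map of the finite set of truncated series is onto, so
    divisibility of \<open>\<psi> f\<close> can be counted on the image.\<close>
  then have im: "?\<phi> ` ?T = ?T"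
    by (intro endo_inj_surj card_fps_trunc) (auto simp: fps_cutoff_in_trunc)
  have "fps_X ^ d dvd \<psi> f \<longleftrightarrow> fps_X ^ d dvd ?\<phi> f" for f
    using \<open>d \<le> m\<close> by (auto simp: fps_X_power_dvd_iff)
  then have "?\<phi> ` {f \<in> ?T. fps_X ^ d dvd \<psi> f} = {f \<in> ?\<phi> ` ?T. fps_X ^ d dvd f}"
    by auto
  then have "?\<phi> ` {f \<in> ?T. fps_X ^ d dvd \<psi> f} = {f \<in> ?T. fps_X ^ d dvd f}"
    using im by simp
  moreover have "card (?\<phi> ` {f \<in> ?T. fps_X ^ d dvd \<psi> f}) = card {f \<in> ?T. fps_X ^ d dvd \<psi> f}"
    using inj by (intro card_image) (rule inj_on_subset, blast+)
  ultimately show ?thesis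
    using card_fps_trunc_dvd(2)[OF \<open>d \<le> m\<close>, where 'a = 'a] by simp
qed

unbundle no Formal_Power_Series.fps_syntax
unbundle Formal_Laurent_Series.fps_syntax

section \<open>Stable lattices in reduced form\<close>

text \<open>
  In the coordinates \<open>s\<^sup>2, s, 1\<close> of \<^const>\<open>E3_of_vec\<close>, the columns are
  \<open>1 + x s + y s\<^sup>2, \<epsilon>^i (s + z s\<^sup>2), \<epsilon>^(i + j) s\<^sup>2\<close> if \<open>t\<close> is false and
  \<open>1 + x s\<^sup>2 + y s, \<epsilon>^i (s\<^sup>2 + \<epsilon> z s), \<epsilon>^(i + j + 1) s\<close> if \<open>t\<close> is true.
\<close>

definition lattice_basis ::
  "bool \<Rightarrow> nat \<Rightarrow> nat \<Rightarrow> 'a::field fps \<Rightarrow> 'a fps \<Rightarrow> 'a fps \<Rightarrow> 'a fps ^3^3" where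
  "lattice_basis t i j x y z =
    (if t then vector [vector [x, fps_X ^ i, 0],
                       vector [y, fps_X ^ (i + 1) * z, fps_X ^ (i + j + 1)],
                       vector [1, 0, 0]]
     else vector [vector [y, fps_X ^ i * z, fps_X ^ (i + j)],
                  vector [x, fps_X ^ i, 0],
                  vector [1, 0, 0]])"

text \<open>Forward substitution in the triangular basis: p is the coefficient of the first column,
  \<open>q - p * x\<close> must be \<epsilon>^i times that of the second, and what is left in the
  last coordinate must be a multiple of the third pivot. The flag \<open>t\<close> exchanges the
  roles of s and s^2.\<close>

definition in_lattice ::
  "bool \<Rightarrow> nat \<Rightarrow> nat \<Rightarrow> 'a::field fps \<Rightarrow> 'a fps \<Rightarrow> 'a fps \<Rightarrow> 'a fps ^3 \<Rightarrow> bool" where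
  "in_lattice t i j x y z v \<longleftrightarrow>
    (let p = v $ 3; q = if t then v $ 1 else v $ 2; r = if t then v $ 2 else v $ 1; d = of_bool t
     in fps_X ^ i dvd q - p * x \<and> fps_X ^ (i + j + d) dvd r - p * y - (q - p * x) * (fps_X ^ d * z))"

lemma in_lattice_False:
  "in_lattice False i j x y z v \<longleftrightarrow> fps_X ^ i dvd v $ 2 - v $ 3 * x \<and>
    fps_X ^ (i + j) dvd v $ 1 - v $ 3 * y - (v $ 2 - v $ 3 * x) * z"
  by (simp add: in_lattice_def Let_def)

lemma in_lattice_True:
  "in_lattice True i j x y z v \<longleftrightarrow> fps_X ^ i dvd v $ 1 - v $ 3 * x \<and>
    fps_X ^ (i + j + 1) dvd v $ 2 - v $ 3 * y - (v $ 1 - v $ 3 * x) * (fps_X * z)"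
  by (simp add: in_lattice_def Let_def)

lemma in_lattice_iff:
  "in_lattice t i j x y z v \<longleftrightarrow> (\<exists>w. v = lattice_basis t i j x y z *v w)"
proof (intro iffI; (elim exE)?)
  fix w assume v: "v = lattice_basis t i j x y z *v w"
  have "v $ 3 = w $ 1" "(if t then v $ 1 else v $ 2) = x * w $ 1 + fps_X ^ i * w $ 2"
    "(if t then v $ 2 else v $ 1) = y * w $ 1 + fps_X ^ (i + of_bool t) * z * w $ 2
       + fps_X ^ (i + j + of_bool t) * w $ 3"
    unfolding v by (simp_all add: lattice_basis_def matrix_vector_mult_def sum_3 vector_3)
  then show "in_lattice t i j x y z v"
    unfolding in_lattice_def Let_def by (simp add: algebra_simps power_add)
next
  assume "in_lattice t i j x y z v"
  then obtain m l where m: "(if t then v $ 1 else v $ 2) - v $ 3 * x = fps_X ^ i * m"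
    and l: "(if t then v $ 2 else v $ 1) - v $ 3 * y - fps_X ^ i * m * (fps_X ^ of_bool t * z) =
      fps_X ^ (i + j + of_bool t) * l"
    unfolding in_lattice_def Let_def by (metis dvdE)
  have "v = lattice_basis t i j x y z *v vector [v $ 3, m, l]"
    using m l by (cases t)
      (simp_all add: lattice_basis_def matrix_vector_mult_def sum_3 vector_3 vec_eq_iff forall_3 algebra_simps)
  then show "\<exists>w. v = lattice_basis t i j x y z *v w" ..
qed

text \<open>Inclusion of the column lattice of A in that of R can be tested column by column, where
  \<open>in_lattice\<close> decides it.\<close>

lemma matrix_factor_iff:
  fixes A R :: "'a::comm_semiring_1 ^'n^'n"
  shows "(\<exists>N. A = R ** N) \<longleftrightarrow> (\<forall>c. \<exists>w. column c A = R *v w)"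
proof
  assume "\<forall>c. \<exists>w. column c A = R *v w"
  then obtain w where w: "\<And>c. column c A = R *v w c" by metis
  have "A = R ** (\<chi> i c. w c $ i)"
    using w by (simp add: vec_eq_iff column_def matrix_matrix_mult_def matrix_vector_mult_def)
  then show "\<exists>N. A = R ** N" ..
qed (auto simp: vec_eq_iff column_def matrix_matrix_mult_def matrix_vector_mult_def intro!: exI[of _ "column _ _"])

section \<open>Stability of reduced lattices under \<open>\<gamma>\<close>\<close>

lemma fps_X_power_dvd_mult_unit:
  fixes u :: "'a::field fps"
  assumes "fps_nth u 0 \<noteq> 0"
  shows "fps_X ^ k dvd fps_X ^ n * u \<longleftrightarrow> k \<le> n"
proof -
  have "fps_X ^ k dvd fps_X ^ n * u \<longleftrightarrow> (fps_X :: 'a fps) ^ k dvd fps_X ^ n"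
    using assms by (simp add: dvd_mult_unit_iff)
  also have "\<dots> \<longleftrightarrow> k \<le> n"
    by (simp add: fps_X_power_dvd_iff fps_X_power_nth not_less)
  finally show ?thesis .
qed

text \<open>The matrix \<open>\<gamma>\<close> with \<epsilon>^n displayed as a common factor; in
  the application \<open>c\<close> contains \<epsilon>^(n2 - n1).\<close>

definition gamma_O :: "nat \<Rightarrow> 'a::field fps \<Rightarrow> 'a fps \<Rightarrow> 'a fps ^3^3" where
  "gamma_O n b c = vector [vector [0, fps_X ^ n * b, fps_X ^ n * c],
                           vector [fps_X ^ (n + 1) * c, 0, fps_X ^ n * b],
                           vector [fps_X ^ (n + 1) * b, fps_X ^ (n + 1) * c, 0]]"

text \<open>For \<open>\<not> t\<close>: \<open>\<gamma>\<close> applied to the first column, minus multiples of the first and second,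
  is \<open>\<epsilon>^n\<close> times this in the coordinate \<open>s\<^sup>2\<close>.\<close>

definition stab_poly :: "'a::field fps \<Rightarrow> 'a fps \<Rightarrow> 'a fps \<Rightarrow> 'a fps \<Rightarrow> 'a fps \<Rightarrow> 'a fps" where
  "stab_poly b c x y z = b * (x - z - fps_X * y * (y - x * z))
      + c * (1 - fps_X * (x * y + y * z - x\<^sup>2 * z))"

text \<open>The images of the three columns are tested by \<open>in_lattice_False\<close>. Column 1
  gives i <= n and the congruence, column 2 gives j <= n, and column 3 passes because it carries the
  factor \<epsilon>^(i + j).\<close>

lemma stable_False_iff:
  fixes b c x y z :: "'a::field fps"
  assumes "b dvd 1"
  shows "(\<exists>N. gamma_O n b c ** lattice_basis False i j x y z = lattice_basis False i j x y z ** N) \<longleftrightarrow>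
    i \<le> n \<and> j \<le> n \<and> fps_X ^ (i + j) dvd fps_X ^ n * stab_poly b c x y z"
proof -
  let ?A = "gamma_O n b c ** lattice_basis False i j x y z"
  let ?in = "in_lattice False i j x y z"
  have b0: "fps_nth b 0 \<noteq> 0" using assms by simp
  \<comment> \<open>\<open>u\<close> is the cofactor in the first divisibility for column 1,
    \<open>v\<close> in the second divisibility for column 2. Both are congruent to b modulo
    \<epsilon>, hence units, so these divisibilities only compare exponents.\<close>
  define u where "u = b + fps_X * (c * y - (b * y + c * x) * x)"
  define v where "v = b - fps_X * (c * z * z + (b * z + c) * (y - x * z))"
  have uv: "fps_nth u 0 \<noteq> 0" "fps_nth v 0 \<noteq> 0" using b0 by (simp_all add: u_def v_def)
  have c1: "column 1 ?A $ 1 = fps_X ^ n * (b * x + c)"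
    "column 1 ?A $ 2 = fps_X ^ n * (fps_X * c * y + b)"
    "column 1 ?A $ 3 = fps_X ^ n * (fps_X * (b * y + c * x))"
    by (simp_all add: column_def matrix_matrix_mult_def sum_3 vector_3 gamma_O_def lattice_basis_def algebra_simps)
  have c2: "column 2 ?A $ 1 = fps_X ^ n * (fps_X ^ i * b)"
    "column 2 ?A $ 2 = fps_X ^ n * (fps_X ^ i * (fps_X * c * z))"
    "column 2 ?A $ 3 = fps_X ^ n * (fps_X ^ i * (fps_X * (b * z + c)))"
    by (simp_all add: column_def matrix_matrix_mult_def sum_3 vector_3 gamma_O_def lattice_basis_def algebra_simps)
  have c3: "column 3 ?A $ 1 = 0"
    "column 3 ?A $ 2 = fps_X ^ (i + j) * (fps_X ^ (n + 1) * c)"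
    "column 3 ?A $ 3 = fps_X ^ (i + j) * (fps_X ^ (n + 1) * b)"
    by (simp_all add: column_def matrix_matrix_mult_def sum_3 vector_3 gamma_O_def lattice_basis_def algebra_simps power_add)
  have e1: "column 1 ?A $ 2 - column 1 ?A $ 3 * x = fps_X ^ n * u"
    "column 1 ?A $ 1 - column 1 ?A $ 3 * y - (column 1 ?A $ 2 - column 1 ?A $ 3 * x) * z =
      fps_X ^ n * stab_poly b c x y z"
    unfolding c1 u_def stab_poly_def by algebra+
  have e2: "column 2 ?A $ 2 - column 2 ?A $ 3 * x =
      fps_X ^ i * (fps_X ^ n * (fps_X * (c * z - (b * z + c) * x)))"
    "column 2 ?A $ 1 - column 2 ?A $ 3 * y - (column 2 ?A $ 2 - column 2 ?A $ 3 * x) * z =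
      fps_X ^ n * (fps_X ^ i * v)"
    unfolding c2 v_def by algebra+
  have e3: "column 3 ?A $ 2 - column 3 ?A $ 3 * x = fps_X ^ (i + j) * (fps_X ^ (n + 1) * (c - b * x))"
    "column 3 ?A $ 1 - column 3 ?A $ 3 * y - (column 3 ?A $ 2 - column 3 ?A $ 3 * x) * z =
      fps_X ^ (i + j) * (- (fps_X ^ (n + 1) * (b * y + (c - b * x) * z)))"
    unfolding c3 by algebra+
  have "?in (column 1 ?A) \<longleftrightarrow> i \<le> n \<and> fps_X ^ (i + j) dvd fps_X ^ n * stab_poly b c x y z"
    unfolding in_lattice_False e1(2) unfolding e1(1) fps_X_power_dvd_mult_unit[OF uv(1)] ..
  moreover have "?in (column 2 ?A) \<longleftrightarrow> j \<le> n"
    using fps_X_power_dvd_mult_unit[OF uv(2), of "i + j" "n + i"]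
    unfolding in_lattice_False e2(2) unfolding e2(1) power_add mult.assoc by simp
  moreover have "?in (column 3 ?A)"
    unfolding in_lattice_False e3(2) unfolding e3(1) power_add mult.assoc by simp
  ultimately show ?thesis
    by (auto simp: matrix_factor_iff forall_3 simp flip: in_lattice_iff)
qed

text \<open>The second divisibility for column 1 concerns \<epsilon>^n times a unit and yields the
  inequality. Then \<epsilon>^(i + j + 1) divides \<epsilon>^n, which settles the remaining tests of
  columns 1 and 2; column 3 carries the factor \<epsilon>^(i + j + 1).\<close>

lemma stable_True_iff:
  fixes b c x y z :: "'a::field fps"
  assumes "b dvd 1"
  shows "(\<exists>N. gamma_O n b c ** lattice_basis True i j x y z = lattice_basis True i j x y z ** N) \<longleftrightarrow>
    i + j + 1 \<le> n"
proof -
  let ?A = "gamma_O n b c ** lattice_basis True i j x y z"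
  let ?in = "in_lattice True i j x y z"
  have b0: "fps_nth b 0 \<noteq> 0" using assms by simp
  \<comment> \<open>The unit is \<open>u\<close>, congruent to b modulo \<epsilon>; \<open>v\<close>
    only names the remaining factor for column 2.\<close>
  define u where "u = b + fps_X * (c * x - (b * x + c * y) * y - (c + b * y - fps_X * (b * x + c * y) * x) * z)"
  define v where "v = c - (b + fps_X * c * z) * y - fps_X * (b * z - (b + fps_X * c * z) * x) * z"
  have u: "fps_nth u 0 \<noteq> 0" using b0 by (simp add: u_def)
  have c1: "column 1 ?A $ 1 = fps_X ^ n * (c + b * y)"
    "column 1 ?A $ 2 = fps_X ^ n * (fps_X * c * x + b)"
    "column 1 ?A $ 3 = fps_X ^ n * (fps_X * (b * x + c * y))"
    by (simp_all add: column_def matrix_matrix_mult_def sum_3 vector_3 gamma_O_def lattice_basis_def algebra_simps)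
  have c2: "column 2 ?A $ 1 = fps_X ^ n * (fps_X ^ i * (fps_X * b * z))"
    "column 2 ?A $ 2 = fps_X ^ n * (fps_X ^ i * (fps_X * c))"
    "column 2 ?A $ 3 = fps_X ^ n * (fps_X ^ i * (fps_X * (b + fps_X * c * z)))"
    by (simp_all add: column_def matrix_matrix_mult_def sum_3 vector_3 gamma_O_def lattice_basis_def algebra_simps)
  have c3: "column 3 ?A $ 1 = fps_X ^ (i + j + 1) * (fps_X ^ n * b)"
    "column 3 ?A $ 2 = 0"
    "column 3 ?A $ 3 = fps_X ^ (i + j + 1) * (fps_X ^ (n + 1) * c)"
    by (simp_all add: column_def matrix_matrix_mult_def sum_3 vector_3 gamma_O_def lattice_basis_def algebra_simps power_add)
  have e1: "column 1 ?A $ 1 - column 1 ?A $ 3 * x = fps_X ^ n * (c + b * y - fps_X * (b * x + c * y) * x)"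
    "column 1 ?A $ 2 - column 1 ?A $ 3 * y - (column 1 ?A $ 1 - column 1 ?A $ 3 * x) * (fps_X * z) =
      fps_X ^ n * u"
    unfolding c1 u_def by algebra+
  have e2: "column 2 ?A $ 1 - column 2 ?A $ 3 * x =
      fps_X ^ i * (fps_X ^ n * (fps_X * (b * z - (b + fps_X * c * z) * x)))"
    "column 2 ?A $ 2 - column 2 ?A $ 3 * y - (column 2 ?A $ 1 - column 2 ?A $ 3 * x) * (fps_X * z) =
      fps_X ^ n * fps_X ^ i * fps_X * v"
    unfolding c2 v_def by algebra+
  have e3: "column 3 ?A $ 1 - column 3 ?A $ 3 * x =
      fps_X ^ (i + j + 1) * (fps_X ^ n * (b - fps_X * c * x))"
    "column 3 ?A $ 2 - column 3 ?A $ 3 * y - (column 3 ?A $ 1 - column 3 ?A $ 3 * x) * (fps_X * z) =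
      fps_X ^ (i + j + 1) * (fps_X ^ (n + 1) * (- c * y - (b - fps_X * c * x) * z))"
    unfolding c3 power_add power_one_right by algebra+
  have "?in (column 1 ?A) \<longleftrightarrow> i + j + 1 \<le> n"
    unfolding in_lattice_True e1(2) unfolding e1(1) fps_X_power_dvd_mult_unit[OF u]
    by (auto intro!: dvd_mult2 le_imp_power_dvd)
  moreover have "?in (column 2 ?A)" if "i + j + 1 \<le> n"
  proof -
    have "(fps_X :: 'a fps) ^ (i + j + 1) dvd fps_X ^ n" using that by (rule le_imp_power_dvd)
    then show ?thesis
      unfolding in_lattice_True e2(2) unfolding e2(1) mult.assoc by simp
  qed
  moreover have "?in (column 3 ?A)"
    unfolding in_lattice_True e3(2) unfolding e3(1) power_add mult.assoc by simp
  ultimately show ?thesis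
    by (auto simp: matrix_factor_iff forall_3 simp flip: in_lattice_iff)
qed

text \<open>All terms in x other than \<open>b * x\<close> carry a factor \<epsilon>, so the
  difference quotient is b plus a multiple of \<epsilon>, a unit. This is the hypothesis on \<psi>
  in \<open>card_fps_trunc_dvd_bij\<close>.\<close>

lemma stab_poly_diff:
  fixes b c x x' y z :: "'a::field fps"
  assumes "b dvd 1"
  shows "\<exists>u. u dvd 1 \<and> stab_poly b c x y z - stab_poly b c x' y z = (x - x') * u"
proof (intro exI conjI)
  show "b + fps_X * (b * y * z - c * (y - (x + x') * z)) dvd 1"
    using assms by simp
  show "stab_poly b c x y z - stab_poly b c x' y z =
      (x - x') * (b + fps_X * (b * y * z - c * (y - (x + x') * z)))"
    unfolding stab_poly_def by algebra
qed

section \<open>Counting the stable reduced lattices\<close>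

definition stable_params ::
  "nat \<Rightarrow> 'a::field fps \<Rightarrow> 'a fps \<Rightarrow> (bool \<times> nat \<times> nat \<times> 'a fps \<times> 'a fps \<times> 'a fps) set" where
  "stable_params n b c = {(t, i, j, x, y, z).
     x \<in> fps_trunc i \<and> y \<in> fps_trunc (i + j + of_bool t) \<and> z \<in> fps_trunc j \<and>
     (if t then i + j + 1 \<le> n
      else i \<le> n \<and> j \<le> n \<and> fps_X ^ (i + j) dvd fps_X ^ n * stab_poly b c x y z)}"

text \<open>If t is false, y and z are free and the congruence leaves i - (i + j - n) free
  coefficients for x; with truncated subtraction the exponents add up to the minimum. If t is true,
  all three series are free, with exponent i + (i + j + 1) + j.\<close>

lemma card_stable_params:
  fixes b c :: "'a::{field,finite} fps"
  assumes "b dvd 1"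
  shows "finite (stable_params n b c)"
    and "card (stable_params n b c) =
      (\<Sum>(i, j)\<in>{..n} \<times> {..n}. CARD('a) ^ min (2 * (i + j)) (i + j + n)) +
      (\<Sum>(i, j)\<in>{(i, j). i + j < n}. CARD('a) ^ (2 * (i + j) + 1))"
proof -
  let ?T = "fps_trunc :: nat \<Rightarrow> 'a fps set"
  define X where "X i j y z = {x \<in> ?T i. fps_X ^ (i + j) dvd fps_X ^ n * stab_poly b c x y z}" for i j y z
  define A where "A = (SIGMA (i, j):{..n} \<times> {..n}. SIGMA (y, z):?T (i + j) \<times> ?T j. X i j y z)"
  define B where "B = (SIGMA (i, j):{(i, j). i + j < n}. ?T i \<times> ?T (i + j + 1) \<times> ?T j)"
  \<comment> \<open>\<open>f\<close> restores the order of the parameters; in \<open>A\<close> the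
    series x comes last because its range depends on y and z.\<close>
  define f where "f = (\<lambda>((i :: nat, j :: nat), (y :: 'a fps, z :: 'a fps), x :: 'a fps). (False, i, j, x, y, z))"
  define g where "g = (\<lambda>((i :: nat, j :: nat), x :: 'a fps, y :: 'a fps, z :: 'a fps). (True, i, j, x, y, z))"
  have fin_ij: "finite {(i :: nat, j). i + j < n}"
    by (rule finite_subset[of _ "{..n} \<times> {..n}"]) auto
  have eq: "stable_params n b c = f ` A \<union> g ` B"
    by (force simp: stable_params_def A_def B_def X_def f_def g_def image_iff)
  have card_X: "card (X i j y z) = CARD('a) ^ (i - (i + j - n))" if "j \<le> n" for i j y z
  proof -
    \<comment> \<open>The factor \<epsilon>^n is cancelled; for i + j <= n both sides hold, since
      \<open>i + j - n\<close> is then 0.\<close>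
    have "fps_X ^ (i + j) dvd fps_X ^ n * p \<longleftrightarrow> fps_X ^ (i + j - n) dvd p" for p :: "'a fps"
    proof (cases "i + j \<le> n")
      case True
      then show ?thesis by (simp add: le_imp_power_dvd dvd_mult2)
    next
      case False
      then have "(fps_X :: 'a fps) ^ (i + j) = fps_X ^ n * fps_X ^ (i + j - n)"
        by (simp only: power_add[symmetric]) simp
      then show ?thesis by (simp only: dvd_mult_cancel_left) simp
    qed
    then have "X i j y z = {x \<in> ?T i. fps_X ^ (i + j - n) dvd stab_poly b c x y z}"
      by (simp add: X_def)
    then show ?thesis
      using card_fps_trunc_dvd_bij[of "i + j - n" i "\<lambda>x. stab_poly b c x y z"] stab_poly_diff[OF assms] that
      by simp
  qed
  have fin_X: "finite (X i j y z)" for i j y z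
    unfolding X_def by (rule finite_subset[OF _ card_fps_trunc(1)[of i]]) blast
  have fin: "finite A" "finite B"
    unfolding A_def B_def using fin_X card_fps_trunc(1) fin_ij
    by (auto intro!: finite_SigmaI)
  have "card A = (\<Sum>(i, j)\<in>{..n} \<times> {..n}. CARD('a) ^ min (2 * (i + j)) (i + j + n))"
  proof -
    have "card (SIGMA (y, z):?T (i + j) \<times> ?T j. X i j y z) = CARD('a) ^ min (2 * (i + j)) (i + j + n)"
      if "i \<le> n" "j \<le> n" for i j
    proof -
      have "card (SIGMA (y, z):?T (i + j) \<times> ?T j. X i j y z) =
          (\<Sum>(y, z)\<in>?T (i + j) \<times> ?T j. card (X i j y z))"
        by (subst card_SigmaI) (auto simp: fin_X card_fps_trunc(1) case_prod_unfold)
      also have "\<dots> = CARD('a) ^ (i + j) * CARD('a) ^ j * CARD('a) ^ (i - (i + j - n))"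
        by (simp add: card_X[OF \<open>j \<le> n\<close>] card_cartesian_product card_fps_trunc(2) case_prod_unfold)
      also have "\<dots> = CARD('a) ^ min (2 * (i + j)) (i + j + n)"
      proof -
        have "i + j + j + (i - (i + j - n)) = min (2 * (i + j)) (i + j + n)"
          using that by (cases "i + j \<le> n") auto
        then show ?thesis by (simp flip: power_add)
      qed
      finally show ?thesis .
    qed
    then show ?thesis
      unfolding A_def by (subst card_SigmaI)
        (auto simp: fin_X card_fps_trunc(1) intro!: sum.cong finite_SigmaI)
  qed
  moreover have "card B = (\<Sum>(i, j)\<in>{(i, j). i + j < n}. CARD('a) ^ (2 * (i + j) + 1))"
  proof -
    have "card (?T i \<times> ?T (i + j + 1) \<times> ?T j) = CARD('a) ^ (2 * (i + j) + 1)" for i j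
    proof -
      have "i + (i + j + 1 + j) = 2 * (i + j) + 1" by simp
      then show ?thesis
        by (simp only: card_cartesian_product card_fps_trunc(2) flip: power_add)
    qed
    then show ?thesis
      unfolding B_def by (subst card_SigmaI)
        (auto simp: fin_ij card_fps_trunc(1) intro!: sum.cong simp del: card_cartesian_product)
  qed
  moreover have "inj_on f A" "inj_on g B" "f ` A \<inter> g ` B = {}"
    by (auto simp: inj_on_def f_def g_def)
  ultimately show "card (stable_params n b c) =
      (\<Sum>(i, j)\<in>{..n} \<times> {..n}. CARD('a) ^ min (2 * (i + j)) (i + j + n)) +
      (\<Sum>(i, j)\<in>{(i, j). i + j < n}. CARD('a) ^ (2 * (i + j) + 1))"
    unfolding eq using fin by (simp add: card_Un_disjoint card_image)
  show "finite (stable_params n b c)"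
    unfolding eq using fin by simp
qed

section \<open>The field \<open>E\<^sub>3\<close> acting on \<open>F\<^sup>3\<close>\<close>

lemma fls_compose_power_3_nth:
  "fls_compose_power f 3 $$ n = (if 3 dvd n then f $$ (n div 3) else 0)"
  by (simp add: fls_nth_compose_power)

text \<open>Each coordinate fills exactly one residue class of exponents modulo 3, so the
  coefficients interleave without overlap. Valuations in E_3 and entries of vectors are compared
  through this formula.\<close>

lemma E3_of_vec_nth:
  "E3_of_vec v $$ n =
    v $ (if n mod 3 = 2 then 1 else if n mod 3 = 1 then 2 else 3) $$ (n div 3)"
proof -
  have "E3_of_vec v $$ n = fls_compose_power (v $ 1) 3 $$ (n - 2)
      + fls_compose_power (v $ 2) 3 $$ (n - 1) + fls_compose_power (v $ 3) 3 $$ n"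
    by (simp add: E3_of_vec_def fls_X_power_times_conv_shift fls_X_times_conv_shift)
  moreover have "n mod 3 = 0 \<or> n mod 3 = 1 \<or> n mod 3 = 2" by presburger
  moreover have "(n - 2) div 3 = n div 3" if "n mod 3 = 2" using that by presburger
  moreover have "(n - 1) div 3 = n div 3" if "n mod 3 = 1" using that by presburger
  moreover have "3 dvd n - 2 \<longleftrightarrow> n mod 3 = 2" "3 dvd n - 1 \<longleftrightarrow> n mod 3 = 1" "3 dvd n \<longleftrightarrow> n mod 3 = 0"
    by presburger+
  ultimately show ?thesis by (auto simp: fls_compose_power_3_nth)
qed

lemma E3_of_vec_add: "E3_of_vec (v + w) = E3_of_vec v + E3_of_vec w"
  by (simp add: E3_of_vec_def algebra_simps)

lemma E3_of_vec_diff: "E3_of_vec (v - w) = E3_of_vec v - E3_of_vec w"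
  by (simp add: E3_of_vec_def algebra_simps)

lemma E3_of_vec_scale: "E3_of_vec (c *s v) = fls_compose_power c 3 * E3_of_vec v"
  by (simp add: E3_of_vec_def algebra_simps)

lemma E3_of_vec_inject [simp]: "E3_of_vec v = E3_of_vec w \<longleftrightarrow> v = w"
proof
  assume eq: "E3_of_vec v = E3_of_vec w"
  have "v $ 1 $$ n = w $ 1 $$ n" "v $ 2 $$ n = w $ 2 $$ n" "v $ 3 $$ n = w $ 3 $$ n" for n
    using arg_cong[OF eq, of "\<lambda>f. f $$ (3 * n + 2)"] arg_cong[OF eq, of "\<lambda>f. f $$ (3 * n + 1)"]
      arg_cong[OF eq, of "\<lambda>f. f $$ (3 * n)"]
    by (simp_all add: E3_of_vec_nth)
  then show "v = w" by (simp add: vec_eq_iff forall_3 fls_eq_iff)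
qed simp

lemma E3_of_vec_zero [simp]: "E3_of_vec 0 = 0"
  by (simp add: E3_of_vec_def)

lemma E3_of_vec_eq_0_iff [simp]: "E3_of_vec v = 0 \<longleftrightarrow> v = 0"
  using E3_of_vec_inject[of v 0] by simp

lemma surj_E3_of_vec: "surj E3_of_vec"
proof (rule surjI)
  fix y :: "'a fls"
  have nth: "Abs_fls (\<lambda>n. y $$ (3 * n + k)) $$ n = y $$ (3 * n + k)" if "k \<le> 2" for k n
  proof (rule nth_Abs_fls_lower_bound)
    \<comment> \<open>\<open>Abs_fls\<close> has the prescribed coefficients only if they vanish
      below some bound. The minimum with 0 gives 3 n <= n, hence 3 n + k <= n + 2, which is below
      the valuation of y.\<close>
    show "\<forall>n < min 0 (fls_subdegree y - 2). y $$ (3 * n + k) = 0"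
      using that by (auto intro!: fls_eq0_below_subdegree)
  qed
  have nth0: "Abs_fls (\<lambda>n. y $$ (3 * n)) $$ n = y $$ (3 * n)" for n
    using nth[of 0] by simp
  show "E3_of_vec (vector [Abs_fls (\<lambda>n. y $$ (3 * n + 2)), Abs_fls (\<lambda>n. y $$ (3 * n + 1)),
      Abs_fls (\<lambda>n. y $$ (3 * n))]) = y"
    unfolding fls_eq_iff
  proof
    fix n :: int
    have "\<exists>m. n = 3 * m + 2 \<or> n = 3 * m + 1 \<or> n = 3 * m" by presburger
    then consider m where "n = 3 * m + 2" | m where "n = 3 * m + 1" | m where "n = 3 * m" by blast
    then show "E3_of_vec (vector [Abs_fls (\<lambda>n. y $$ (3 * n + 2)), Abs_fls (\<lambda>n. y $$ (3 * n + 1)),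
        Abs_fls (\<lambda>n. y $$ (3 * n))]) $$ n = y $$ n"
      by cases (simp_all add: E3_of_vec_nth nth nth0)
  qed
qed

text \<open>The regular representation of E_3 over F; the image of the nonzero elements is the torus
  T.\<close>

definition E3_mult :: "'k::field fls \<Rightarrow> 'k fls ^3^3" where
  "E3_mult x = matrix (\<lambda>v. inv_into UNIV E3_of_vec (x * E3_of_vec v))"

lemma E3_of_vec_E3_mult: "E3_of_vec (E3_mult x *v v) = x * E3_of_vec v"
proof -
  have sec: "E3_of_vec (inv_into UNIV E3_of_vec y) = y" for y :: "'a fls"
    using surj_E3_of_vec by (rule surj_f_inv_f)
  have "Vector_Spaces.linear (*s) (*s) (\<lambda>v. inv_into UNIV E3_of_vec (x * E3_of_vec v))"
    by unfold_locales
      (simp_all add: sec E3_of_vec_add E3_of_vec_scale algebra_simps flip: E3_of_vec_inject)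
  from matrix_works[OF this] show ?thesis by (simp add: E3_mult_def sec)
qed

lemma E3_mult_eqI:
  assumes "\<And>v. E3_of_vec (A *v v) = x * E3_of_vec v"
  shows "A = E3_mult x"
  using assms by (simp add: matrix_eq flip: E3_of_vec_inject add: E3_of_vec_E3_mult)

lemma E3_mult_mult: "E3_mult (x * y) = E3_mult x ** E3_mult y"
  by (rule E3_mult_eqI[symmetric])
    (simp add: E3_of_vec_E3_mult mult.assoc flip: matrix_vector_mul_assoc)

lemma E3_mult_1 [simp]: "E3_mult 1 = mat 1"
  by (rule E3_mult_eqI[symmetric]) simp

lemma E3_mult_commute: "E3_mult x ** E3_mult y = E3_mult y ** E3_mult x"
  by (simp add: mult.commute flip: E3_mult_mult)

lemma invertible_E3_mult:
  assumes "x \<noteq> 0"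
  shows "invertible (E3_mult x)"
  unfolding invertible_def
  by (rule exI[of _ "E3_mult (inverse x)"]) (simp add: assms flip: E3_mult_mult)

lemma E3_units_eq: "E3_units = (\<lambda>u. E3_mult (fps_to_fls u)) ` {u. u dvd 1}"
  by (auto simp: E3_units_def E3_of_vec_E3_mult intro: E3_mult_eqI)

section \<open>Integral matrices and determinants\<close>

lemma det_GL_O:
  fixes k :: "'k::field fls ^3^3"
  assumes "k \<in> GL_O"
  shows "det k \<noteq> 0" "fls_subdegree (det k) = 0"
proof -
  obtain A :: "'k fps ^3^3" where k: "k = map_matrix fps_to_fls A" and A: "invertible A"
    using assms by (auto simp: GL_O_def)
  obtain B where "A ** B = mat 1" using A by (auto simp: invertible_def)
  then have "det A * det B = 1" by (metis det_I det_mul)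
  then have "det A dvd 1" by (metis dvdI)
  moreover have "det k = fps_to_fls (det A)"
    unfolding k det_3 by (simp add: fls_times_fps_to_fls)
  ultimately show "det k \<noteq> 0" "fls_subdegree (det k) = 0"
    by (auto simp: fls_subdegree_fls_to_fps)
qed

lemma map_matrix_mult:
  fixes A B :: "'k::field fps ^3^3"
  shows "map_matrix fps_to_fls (A ** B) = map_matrix fps_to_fls A ** map_matrix fps_to_fls B"
  by (simp add: vec_eq_iff matrix_matrix_mult_def sum_3 fls_times_fps_to_fls)

lemma map_matrix_inject:
  fixes A B :: "'k::field fps ^3^3"
  shows "map_matrix fps_to_fls A = map_matrix fps_to_fls B \<longleftrightarrow> A = B"
  by (simp add: vec_eq_iff)

lemma map_matrix_1: "map_matrix fps_to_fls (mat 1) = (mat 1 :: 'k::field fls ^3^3)"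
  by (simp add: vec_eq_iff mat_def)

lemma range_fps_to_fls_iff: "f \<in> range fps_to_fls \<longleftrightarrow> (\<forall>n<0. f $$ n = 0)"
proof
  assume "\<forall>n<0. f $$ n = 0"
  then have "f = fps_to_fls (fls_regpart f)" by (simp add: fls_eq_iff)
  then show "f \<in> range fps_to_fls" by blast
qed auto

text \<open>The elements s^2, s, 1 form an \<O>-basis of the ring of integers of E_3: for 0 <= k <=
  2 the exponent 3 n + k is negative exactly when n is.\<close>

lemma E3_of_vec_integral_iff:
  "E3_of_vec v \<in> range fps_to_fls \<longleftrightarrow> (\<forall>i. v $ i \<in> range fps_to_fls)"
proof
  assume *: "E3_of_vec v \<in> range fps_to_fls"
  have "v $ 1 $$ n = 0" "v $ 2 $$ n = 0" "v $ 3 $$ n = 0" if "n < 0" for n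
    using *[unfolded range_fps_to_fls_iff, rule_format, of "3 * n + 2"]
      *[unfolded range_fps_to_fls_iff, rule_format, of "3 * n + 1"]
      *[unfolded range_fps_to_fls_iff, rule_format, of "3 * n"] that
    by (simp_all add: E3_of_vec_nth)
  then show "\<forall>i. v $ i \<in> range fps_to_fls" by (simp add: forall_3 range_fps_to_fls_iff)
next
  assume "\<forall>i. v $ i \<in> range fps_to_fls"
  then show "E3_of_vec v \<in> range fps_to_fls"
    unfolding range_fps_to_fls_iff E3_of_vec_nth by (simp add: div_neg_pos_less0)
qed

lemma matrix_vector_mult_axis: "A *v axis j 1 = column j (A :: 'a::comm_semiring_1 ^'n^'m)"
  by (simp add: vec_eq_iff matrix_vector_mult_def column_def axis_def if_distrib if_distribR cong: if_cong)

lemma E3_mult_integral: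
  "\<exists>U. E3_mult (fps_to_fls u) = map_matrix fps_to_fls U"
proof -
  have "E3_of_vec (axis j 1 :: 'a fls ^3) \<in> range fps_to_fls" for j
    unfolding E3_of_vec_integral_iff by (simp add: range_fps_to_fls_iff axis_def)
  then have "fps_to_fls u * E3_of_vec (axis j 1 :: 'a fls ^3) \<in> range fps_to_fls" for j
    by (metis (no_types) fls_times_fps_to_fls imageE rangeI)
  then have "E3_of_vec (column j (E3_mult (fps_to_fls u))) \<in> range fps_to_fls" for j
    by (simp add: E3_of_vec_E3_mult flip: matrix_vector_mult_axis)
  then have "\<forall>i j. \<exists>y. E3_mult (fps_to_fls u) $ i $ j = fps_to_fls y"
    unfolding E3_of_vec_integral_iff column_def by auto
  then obtain y where "\<And>i j. E3_mult (fps_to_fls u) $ i $ j = fps_to_fls (y i j)" by metis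
  then show ?thesis by (intro exI[of _ "\<chi> i j. y i j"]) (simp add: vec_eq_iff)
qed

text \<open>Both u and its inverse preserve the ring of integers, that is, the standard lattice, so
  both matrices are integral.\<close>

lemma E3_mult_unit_in_GL_O:
  fixes u :: "'k::field fps"
  assumes "u dvd 1"
  shows "E3_mult (fps_to_fls u) \<in> GL_O"
proof -
  obtain u' where u': "u * u' = 1" using assms by (metis dvdE)
  obtain U U' where U: "E3_mult (fps_to_fls u) = map_matrix fps_to_fls U"
    "E3_mult (fps_to_fls u') = map_matrix fps_to_fls U'"
    using E3_mult_integral by meson
  have "map_matrix fps_to_fls (U ** U') = E3_mult (fps_to_fls (u * u'))"
     "map_matrix fps_to_fls (U' ** U) = E3_mult (fps_to_fls (u * u'))"
    by (simp_all add: map_matrix_mult U[symmetric] fls_times_fps_to_fls mult.commute flip: E3_mult_mult)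
  then have "U ** U' = mat 1" "U' ** U = mat 1"
    by (simp_all add: u' flip: map_matrix_inject map_matrix_1)
  then show ?thesis by (auto simp: U(1) GL_O_def invertible_def)
qed

lemma det_E3_mult_X: "det (E3_mult (fls_X :: 'k::field fls)) = fls_X"
proof -
  let ?S = "vector [vector [0, 1, 0], vector [0, 0, 1], vector [fls_X, 0, 0]] :: 'k fls ^3^3"
  have "E3_mult fls_X = ?S"
    \<comment> \<open>Multiplication by s is the matrix of \<open>E3_of_vec_gamma\<close> with b = 1
      and c = 0.\<close>
    using E3_of_vec_gamma[of "1 :: 'k fls" 0] by (intro E3_mult_eqI[symmetric]) simp
  then show ?thesis by (simp add: det_3 vector_3)
qed

text \<open>Both sides turn products into sums and agree on s and on units, which generate the
  multiplicative group. No factor appears because E_3 is totally ramified: the norm of s has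
  valuation 1 in F.\<close>

lemma subdegree_det_E3_mult:
  fixes x :: "'k::field fls"
  assumes "x \<noteq> 0"
  shows "fls_subdegree (det (E3_mult x)) = fls_subdegree x"
proof -
  let ?d = "\<lambda>x :: 'k fls. fls_subdegree (det (E3_mult x))"
  have d_mult: "?d (x * y) = ?d x + ?d y" if "x \<noteq> 0" "y \<noteq> 0" for x y
    using that invertible_E3_mult[of x] invertible_E3_mult[of y]
    by (simp add: E3_mult_mult det_mul invertible_det_nz)
  have d_pow: "?d (fls_X ^ n) = int n" for n
    by (induction n) (simp_all add: d_mult det_E3_mult_X)
  have d_neg: "?d (fls_X_intpow (- m)) = - ?d (fls_X_intpow m)" for m
    using d_mult[of "fls_X_intpow m" "fls_X_intpow (- m)"] by (simp add: fls_X_intpow_times_conv_shift fls_shift_eq0_iff)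
  have d_X: "?d (fls_X_intpow m) = m" for m
  proof (cases m)
    case (nonneg n)
    then show ?thesis using d_pow[of n] by (simp add: fls_X_power_conv_shift_1)
  next
    case (neg n)
    then show ?thesis using d_pow[of "Suc n"] d_neg[of "int (Suc n)"]
      by (simp add: fls_X_power_conv_shift_1 del: power_Suc)
  qed
  define u where "u = fls_base_factor_to_fps x"
  have "x = fps_to_fls u * fls_X_intpow (fls_subdegree x)"
    unfolding u_def fps_to_fls_base_factor_to_fps by (rule fls_base_factor_X_power_decompose)
  moreover have "fps_nth u 0 \<noteq> 0"
    unfolding u_def using assms by (rule fls_base_factor_to_fps_base)
  then have "?d (fps_to_fls u) = 0" "u \<noteq> 0"
    using det_GL_O(2)[OF E3_mult_unit_in_GL_O, of u] by auto
  ultimately show ?thesis using d_mult[of "fps_to_fls u" "fls_X_intpow (fls_subdegree x)"] d_X by simp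
qed

section \<open>Reduction of lattices\<close>

lemma invertible_3:
  fixes A :: "'a::comm_ring_1 ^3^3"
  assumes "det A dvd 1"
  shows "invertible A"
proof -
  obtain e where e: "det A * e = 1" using assms by (metis dvdE)
  \<comment> \<open>\<open>B\<close> is the adjugate of A; dividing it by the determinant means
    multiplying by \<open>e\<close>.\<close>
  define B :: "'a ^3^3" where "B = vector
    [vector [A$2$2 * A$3$3 - A$2$3 * A$3$2, A$1$3 * A$3$2 - A$1$2 * A$3$3, A$1$2 * A$2$3 - A$1$3 * A$2$2],
     vector [A$2$3 * A$3$1 - A$2$1 * A$3$3, A$1$1 * A$3$3 - A$1$3 * A$3$1, A$1$3 * A$2$1 - A$1$1 * A$2$3],
     vector [A$2$1 * A$3$2 - A$2$2 * A$3$1, A$1$2 * A$3$1 - A$1$1 * A$3$2, A$1$1 * A$2$2 - A$1$2 * A$2$1]]"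
  have "A ** B = mat (det A)" "B ** A = mat (det A)"
    by (simp_all add: vec_eq_iff forall_3 matrix_matrix_mult_def sum_3 mat_def B_def vector_3 det_3 algebra_simps)
  then have AB: "(A ** B) $ i $ j = (if i = j then det A else 0)" 
    "(B ** A) $ i $ j = (if i = j then det A else 0)" for i j
    by (simp_all add: mat_def)
  define C where "C = (\<chi> i j. B $ i $ j * e)"
  have "(A ** C) $ i $ j = (A ** B) $ i $ j * e" "(C ** A) $ i $ j = (B ** A) $ i $ j * e" for i j
    by (simp_all add: C_def matrix_matrix_mult_def sum_distrib_left sum_distrib_right mult_ac)
  then have "A ** C = mat 1" "C ** A = mat 1"
    unfolding vec_eq_iff by (auto simp: AB e mat_def)
  then show ?thesis by (auto simp: invertible_def)
qed

lemma GL_O_mult: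
  fixes k l :: "'k::field fls ^3^3"
  assumes "k \<in> GL_O" "l \<in> GL_O"
  shows "k ** l \<in> GL_O"
  using assms by (auto simp: GL_O_def invertible_mult simp flip: map_matrix_mult)

lemma GL_O_inverse:
  fixes k :: "'k::field fls ^3^3"
  assumes "k \<in> GL_O"
  obtains l where "l \<in> GL_O" "k ** l = mat 1" "l ** k = mat 1"
proof -
  obtain A :: "'k fps ^3^3" where A: "invertible A" and k: "k = map_matrix fps_to_fls A"
    using assms by (auto simp: GL_O_def)
  then obtain B where B: "A ** B = mat 1" "B ** A = mat 1" by (auto simp: invertible_def)
  show thesis
  proof (rule that[of "map_matrix fps_to_fls B"])
    show "map_matrix fps_to_fls B \<in> GL_O" using B by (auto simp: GL_O_def invertible_def)
  qed (simp_all add: k B map_matrix_1 flip: map_matrix_mult)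
qed

lemma GL_O_I:
  fixes A :: "'k::field fps ^3^3"
  assumes "det A dvd 1"
  shows "map_matrix fps_to_fls A \<in> GL_O"
  using invertible_3[OF assms] by (auto simp: GL_O_def)

lemma GL_O_invertible:
  fixes k :: "'k::field fls ^3^3"
  shows "k \<in> GL_O \<Longrightarrow> invertible k"
  using det_GL_O(1)[of k] by (simp add: invertible_det_nz)

section \<open>Valuations of columns\<close>

lemma column_mult: "column j (A ** B) = A *v column j B"
  by (simp add: vec_eq_iff column_def matrix_matrix_mult_def matrix_vector_mult_def)

abbreviation col_val :: "'k::field fls ^3^3 \<Rightarrow> 3 \<Rightarrow> int" where
  "col_val g j \<equiv> fls_subdegree (E3_of_vec (column j g))"

lemma column_nonzero:
  fixes g :: "'k::field ^'n^'n"
  assumes "invertible g"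
  shows "column j g \<noteq> 0"
proof
  assume "column j g = 0"
  moreover obtain B where "B ** g = mat 1" using assms by (auto simp: invertible_def)
  ultimately have "column j (mat 1 :: 'k ^'n^'n) = 0"
    by (metis column_mult matrix_vector_mult_0_right)
  then have "column j (mat 1 :: 'k ^'n^'n) $ j = (0 :: 'k ^'n) $ j" by (rule arg_cong)
  then show False by (simp add: column_def mat_def)
qed

text \<open>Valuations of factors add up. The offsets a, b, c are meant to be the valuations of s^2,
  s, 1, so that each hypothesis bounds an entry of a matrix by the valuation of its column.\<close>

lemma fls_prod3_nth_eq_0:
  fixes f g h :: "'a::idom fls"
  assumes "\<And>n. 3 * n + a < A \<Longrightarrow> f $$ n = 0" "\<And>n. 3 * n + b < B \<Longrightarrow> g $$ n = 0"
    "\<And>n. 3 * n + c < C \<Longrightarrow> h $$ n = 0" and n: "3 * n + a + b + c < A + B + C"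
  shows "(f * g * h) $$ n = 0"
proof (cases "f = 0 \<or> g = 0 \<or> h = 0")
  case False
  then have "f $$ fls_subdegree f \<noteq> 0" "g $$ fls_subdegree g \<noteq> 0" "h $$ fls_subdegree h \<noteq> 0"
    by simp_all
  then have "\<not> 3 * fls_subdegree f + a < A" "\<not> 3 * fls_subdegree g + b < B"
    "\<not> 3 * fls_subdegree h + c < C"
    using assms(1-3) by blast+
  then have "n < fls_subdegree (f * g * h)" using False n by simp
  then show ?thesis by (rule fls_eq0_below_subdegree)
qed auto

text \<open>Every term of the determinant takes one entry from each row and each column, and the row
  offsets add up to 2 + 1 + 0 = 3. A larger sum would push all six terms beyond the valuation of
  \<open>det g\<close>. This bound makes the reduction terminate.\<close>

lemma sum_col_val_le:
  fixes g :: "'k::field fls ^3^3"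
  assumes "invertible g"
  shows "(\<Sum>j\<in>UNIV. col_val g j) \<le> 3 * fls_subdegree (det g) + 3"
proof (rule ccontr)
  \<comment> \<open>\<open>e r\<close> is the valuation in E_3 of the r-th basis vector among s^2,
    s, 1.\<close>
  define e :: "3 \<Rightarrow> int" where "e r = (if r = 1 then 2 else if r = 2 then 1 else 0)" for r
  have e: "e 1 = 2" "e 2 = 1" "e 3 = 0" by (simp_all add: e_def)
  let ?n = "fls_subdegree (det g)"
  assume "\<not> ?thesis"
  then have less: "3 * ?n + 3 < col_val g 1 + col_val g 2 + col_val g 3"
    by (simp add: sum_3 not_le)
  have entry: "g $ r $ j $$ n = 0" if "3 * n + e r < col_val g j" for r j n
  proof -
    have "E3_of_vec (column j g) $$ (3 * n + e r) = 0"
      using that by (rule fls_eq0_below_subdegree)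
    then show ?thesis using exhaust_3[of r] by (auto simp: E3_of_vec_nth column_def e)
  qed
  have "(g $ 1 $ i * g $ 2 $ j * g $ 3 $ k) $$ ?n = 0"
    if "col_val g i + col_val g j + col_val g k = col_val g 1 + col_val g 2 + col_val g 3" for i j k
  proof (rule fls_prod3_nth_eq_0)
    show "g $ 1 $ i $$ n = 0" if "3 * n + e 1 < col_val g i" for n using that by (rule entry)
    show "g $ 2 $ j $$ n = 0" if "3 * n + e 2 < col_val g j" for n using that by (rule entry)
    show "g $ 3 $ k $$ n = 0" if "3 * n + e 3 < col_val g k" for n using that by (rule entry)
    show "3 * ?n + e 1 + e 2 + e 3 < col_val g i + col_val g j + col_val g k"
      using less that unfolding e by linarith
  qed
  then have "det g $$ ?n = 0"
    by (simp add: det_3)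
  moreover have "det g \<noteq> 0" using assms by (simp add: invertible_det_nz)
  ultimately show False by (simp add: nth_fls_subdegree_zero_iff)
qed

text \<open>The leading terms of two columns whose valuations agree modulo 3 can be cancelled.\<close>

lemma increase_col_val:
  fixes g :: "'k::field fls ^3^3"
  assumes g: "invertible g" and ab: "a \<noteq> b" "col_val g a mod 3 = col_val g b mod 3"
    and le: "col_val g b \<le> col_val g a"
  obtains k where "k \<in> GL_O" "(\<Sum>j\<in>UNIV. col_val g j) < (\<Sum>j\<in>UNIV. col_val (g ** k) j)"
proof -
  let ?a = "E3_of_vec (column a g)" and ?b = "E3_of_vec (column b g)"
  \<comment> \<open>Adding \<open>c\<close> times \<epsilon>^m times column b to column a cancels
    the leading term of column a, because \<epsilon>^m has valuation 3 m in E_3. \<open>K\<close> is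
    the elementary matrix of this operation.\<close>
  define m where "m = nat ((col_val g a - col_val g b) div 3)"
  have m: "3 * int m = col_val g a - col_val g b"
  proof -
    have "3 dvd col_val g a - col_val g b" using ab(2) by (simp add: mod_eq_dvd_iff)
    then show ?thesis using le by (auto simp: m_def elim!: dvdE)
  qed
  define c where "c = - (?a $$ col_val g a / ?b $$ col_val g b)"
  define y where "y = fps_const c * fps_X ^ m"
  define K :: "'k fps ^3^3" where "K = (\<chi> i j. if i = j then 1 else if i = b \<and> j = a then y else 0)"
  define k where "k = map_matrix fps_to_fls K"
  have "det K = 1"
    using exhaust_3[of a] exhaust_3[of b] ab(1) by (auto simp: det_3 K_def)
  then have k: "k \<in> GL_O" unfolding k_def by (intro GL_O_I) simp
  have y: "fls_compose_power (fps_to_fls y) 3 = fls_const c * fls_X_intpow (3 * int m)"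
    by (simp add: y_def fls_times_fps_to_fls fps_to_fls_power fls_X_power_conv_shift_1)
  have y: "fls_compose_power (fps_to_fls y) 3 * f = fls_const c * fls_shift (- (3 * int m)) f" for f
    unfolding y mult.assoc by (simp only: fls_X_intpow_times_conv_shift(1))
  have "column a k = axis a 1 + fps_to_fls y *s axis b 1"
    using ab(1) by (auto simp: vec_eq_iff column_def k_def K_def axis_def)
  then have "column a (g ** k) = g *v (axis a 1 + fps_to_fls y *s axis b 1)"
    by (simp only: column_mult)
  also have "\<dots> = column a g + fps_to_fls y *s column b g"
    by (simp add: matrix_vector_right_distrib vector_scalar_commute matrix_vector_mult_axis)
  finally have col: "column a (g ** k) = column a g + fps_to_fls y *s column b g" .
  have nth: "E3_of_vec (column a (g ** k)) $$ n = ?a $$ n + c * ?b $$ (n - 3 * int m)" for n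
    by (simp add: col E3_of_vec_add E3_of_vec_scale y)
  have inv: "invertible (g ** k)" using g k by (simp add: invertible_mult GL_O_invertible)
  have "col_val g a < col_val (g ** k) a"
  proof (rule fls_subdegree_greaterI)
    show "E3_of_vec (column a (g ** k)) \<noteq> 0" using column_nonzero[OF inv] by simp
    have "?b \<noteq> 0" using column_nonzero[OF g] by simp
    fix n assume "n \<le> col_val g a"
    then consider "n = col_val g a" | "n < col_val g a" by linarith
    then show "E3_of_vec (column a (g ** k)) $$ n = 0"
    proof cases
      case 1
      then have "n - 3 * int m = col_val g b" using m by simp
      then show ?thesis using \<open>?b \<noteq> 0\<close> 1 by (simp add: nth c_def)
    next
      case 2
      then have "n - 3 * int m < col_val g b" using m by simp
      then show ?thesis using 2 by (simp add: nth)
    qed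
  qed
  moreover have "column j (g ** k) = column j g" if "j \<noteq> a" for j
  proof -
    have "column j k = axis j 1" using that by (auto simp: vec_eq_iff column_def k_def K_def axis_def)
    then show ?thesis by (simp add: column_mult matrix_vector_mult_axis)
  qed
  ultimately have "(\<Sum>j\<in>UNIV. col_val g j) < (\<Sum>j\<in>UNIV. col_val (g ** k) j)"
    by (intro sum_strict_mono_ex1) (auto simp: less_imp_le, metis order.refl less_imp_le)
  with k show thesis by (rule that)
qed

text \<open>By \<open>sum_col_val_le\<close> some k maximizes the sum of the column valuations; two
  equal residues would let \<open>increase_col_val\<close> enlarge it further.\<close>

lemma exists_distinct_residues:
  fixes g :: "'k::field fls ^3^3"
  assumes g: "invertible g"
  obtains k where "k \<in> GL_O" "inj (\<lambda>j. col_val (g ** k) j mod 3)"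
proof -
  define \<mu> where "\<mu> k = nat (3 * fls_subdegree (det g) + 3 - (\<Sum>j\<in>UNIV. col_val (g ** k) j))"
    for k :: "'k fls ^3^3"
  have "mat 1 \<in> (GL_O :: ('k fls ^3^3) set)"
    using GL_O_I[of "mat 1"] by (simp add: map_matrix_1)
  then obtain k :: "'k fls ^3^3" where k: "k \<in> GL_O" and min: "\<And>l. l \<in> GL_O \<Longrightarrow> \<mu> k \<le> \<mu> l"
    using ex_has_least_nat[of "\<lambda>k. k \<in> GL_O" _ \<mu>] by blast
  have "inj (\<lambda>j. col_val (g ** k) j mod 3)"
  proof (rule ccontr)
    assume "\<not> ?thesis"
    then obtain a b where "a \<noteq> b" "col_val (g ** k) a mod 3 = col_val (g ** k) b mod 3"
      by (auto simp: inj_def)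
    moreover have inv: "invertible (g ** k)" using g k by (simp add: invertible_mult GL_O_invertible)
    ultimately obtain l where l: "l \<in> GL_O"
      and less: "(\<Sum>j\<in>UNIV. col_val (g ** k) j) < (\<Sum>j\<in>UNIV. col_val (g ** k ** l) j)"
      using increase_col_val[OF inv, of a b] increase_col_val[OF inv, of b a] by (metis linear)
    have kl: "k ** l \<in> GL_O" using k l by (rule GL_O_mult)
    \<comment> \<open>The bound for the enlarged sum keeps the argument of \<open>nat\<close> in
      \<open>\<mu> k\<close> positive, so that \<mu> really drops.\<close>
    have "(\<Sum>j\<in>UNIV. col_val (g ** (k ** l)) j) \<le> 3 * fls_subdegree (det g) + 3"
      using sum_col_val_le[of "g ** (k ** l)"] g kl det_GL_O[OF kl]
      by (simp add: invertible_mult GL_O_invertible det_mul invertible_det_nz)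
    then have "\<mu> (k ** l) < \<mu> k" using less by (simp add: \<mu>_def matrix_mul_assoc)
    with min[OF kl] show False by simp
  qed
  with k show thesis by (rule that)
qed

lemma exists_sorted_columns:
  fixes g :: "'k::field fls ^3^3"
  assumes g: "invertible g"
  obtains k where "k \<in> GL_O" "inj (\<lambda>j. col_val (g ** k) j mod 3)"
    "col_val (g ** k) 1 < col_val (g ** k) 2" "col_val (g ** k) 2 < col_val (g ** k) 3"
proof -
  obtain l where l: "l \<in> GL_O" and inj: "inj (\<lambda>j. col_val (g ** l) j mod 3)"
    using exists_distinct_residues[OF g] .
  let ?h = "g ** l"
  have "col_val ?h i \<noteq> col_val ?h j" if "i \<noteq> j" for i j using inj that by (metis injD)
  then have "col_val ?h 1 \<noteq> col_val ?h 2" "col_val ?h 1 \<noteq> col_val ?h 3" "col_val ?h 2 \<noteq> col_val ?h 3"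
    by simp_all
  then have "\<exists>a b c. a \<noteq> b \<and> b \<noteq> c \<and> a \<noteq> c \<and> col_val ?h a < col_val ?h b \<and> col_val ?h b < col_val ?h c"
    by (smt (verit, ccfv_threshold) one_neq_zero num1_eq_iff zero_neq_numeral exhaust_3)
  then obtain a b c :: 3 where abc: "a \<noteq> b" "b \<noteq> c" "a \<noteq> c"
    "col_val ?h a < col_val ?h b" "col_val ?h b < col_val ?h c" by blast
  \<comment> \<open>\<open>\<sigma>\<close> lists the columns by increasing valuation, and
    \<open>P\<close> is its permutation matrix, of determinant 1 or -1.\<close>
  define \<sigma> :: "3 \<Rightarrow> 3" where "\<sigma> j = (if j = 1 then a else if j = 2 then b else c)" for j
  define P :: "'k fps ^3^3" where "P = (\<chi> i j. if i = \<sigma> j then 1 else 0)"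
  have "inj \<sigma>" using abc by (auto simp: inj_def \<sigma>_def forall_3)
  have "det P = 1 \<or> det P = - 1"
    using exhaust_3[of a] exhaust_3[of b] exhaust_3[of c] abc(1-3)
    by (elim disjE) (simp_all add: det_3 P_def \<sigma>_def)
  then have P: "map_matrix fps_to_fls P \<in> GL_O" by (intro GL_O_I) auto
  have "column j (map_matrix fps_to_fls P) = axis (\<sigma> j) 1" for j
    by (auto simp: vec_eq_iff column_def P_def axis_def)
  then have col: "column j (g ** (l ** map_matrix fps_to_fls P)) = column (\<sigma> j) ?h" for j
    by (simp add: matrix_mul_assoc column_mult[of _ ?h] matrix_vector_mult_axis)
  show thesis
  proof (rule that[of "l ** map_matrix fps_to_fls P"])
    show "l ** map_matrix fps_to_fls P \<in> GL_O" using l P by (rule GL_O_mult)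
    show "inj (\<lambda>j. col_val (g ** (l ** map_matrix fps_to_fls P)) j mod 3)"
      using inj_compose[OF inj \<open>inj \<sigma>\<close>] by (simp add: col o_def)
  qed (use abc in \<open>simp_all add: col \<sigma>_def\<close>)
qed

text \<open>Serves both types, with d = 0 or d = 1. The series p, q, r are the first column, and p',
  q', r' describe the second one up to powers of \<epsilon>. First x is read off; the last condition
  on the first column then expresses y through z, and substitution into the condition on the second
  column leaves a linear equation for z.\<close>

lemma exists_reduced_coeffs:
  fixes p q r p' P q' r' :: "'a::field fps"
  assumes p: "fps_nth p 0 \<noteq> 0" and q': "fps_nth q' 0 \<noteq> 0" and P: "fps_X ^ d * P = fps_X * p'"
  obtains x y z where "x \<in> fps_trunc i" "y \<in> fps_trunc (i + j + d)" "z \<in> fps_trunc j"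
    "fps_X ^ i dvd q - p * x" "fps_X ^ (i + j + d) dvd r - p * y - (q - p * x) * (fps_X ^ d * z)"
    "fps_X ^ j dvd r' - P * y - (q' - fps_X * p' * x) * z"
proof -
  have pinv: "p * inverse p = 1" using p by (simp add: inverse_mult_eq_1')
  define x where "x = fps_cutoff i (q * inverse p)"
  have "q - p * x = p * (q * inverse p - x)" using pinv by algebra
  then have x: "fps_X ^ i dvd q - p * x" by (simp add: x_def dvd_diff_cutoff)
  then obtain m where m: "q - p * x = fps_X ^ i * m" by (elim dvdE)
  \<comment> \<open>\<open>U\<close> is the coefficient of z after y has been eliminated; its
    constant term is that of q', so it is a unit.\<close>
  define U where "U = q' - fps_X * p' * x - fps_X * p' * inverse p * fps_X ^ i * m"
  have "fps_nth U 0 \<noteq> 0" using q' by (simp add: U_def mult.assoc)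
  then have Uinv: "U * inverse U = 1" by (simp add: inverse_mult_eq_1')
  define z where "z = fps_cutoff j ((r' - P * r * inverse p) * inverse U)"
  define Y where "Y = (r - fps_X ^ i * m * (fps_X ^ d * z)) * inverse p"
  define y where "y = fps_cutoff (i + j + d) Y"
  have y: "fps_X ^ (i + j + d) dvd Y - y" by (simp add: y_def dvd_diff_cutoff)
  have ring1: "r - p * y - W = p * ((r - W) * inverse p - y)" for W
    using pinv by algebra
  have "r - p * y - (q - p * x) * (fps_X ^ d * z) = p * (Y - y)"
    unfolding m Y_def by (rule ring1)
  then have 2: "fps_X ^ (i + j + d) dvd r - p * y - (q - p * x) * (fps_X ^ d * z)"
    using y by simp
  \<comment> \<open>The elimination as a polynomial identity: w and v stand for the inverses of p
    and \<open>U\<close>, e and D for \<epsilon>^i and \<epsilon>^d.\<close>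
  have ring2: "r' - P * y - u * z =
      (u - w * P' * e * m) * ((r' - P * r * w) * v - z) + P * ((r - e * m * (D * z)) * w - y)"
    if "(u - w * P' * e * m) * v = 1" "D * P = P'" for u w v P' e D :: "'a fps"
    using that by algebra
  have "r' - P * y - (q' - fps_X * p' * x) * z =
      U * ((r' - P * r * inverse p) * inverse U - z) + P * (Y - y)"
    using ring2[of "q' - fps_X * p' * x" "inverse p" "fps_X * p'" "fps_X ^ i" "inverse U" "fps_X ^ d"] Uinv P
    unfolding Y_def U_def by (simp only: mult.commute[of "inverse p"] mult.assoc)
  moreover have "fps_X ^ j dvd (r' - P * r * inverse p) * inverse U - z"
    by (simp add: z_def dvd_diff_cutoff)
  moreover have "fps_X ^ j dvd Y - y"
    using y by (rule dvd_trans[rotated]) (simp add: le_imp_power_dvd)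
  ultimately have 3: "fps_X ^ j dvd r' - P * y - (q' - fps_X * p' * x) * z" by simp
  show thesis
    by (rule that[OF _ _ _ x 2 3]) (simp_all add: x_def y_def z_def fps_cutoff_in_trunc)
qed

lemma E3_nth_map:
  "E3_of_vec (\<chi> r. fps_to_fls (v $ r)) $$ (3 * int m + 2) = fps_nth (v $ 1) m"
  "E3_of_vec (\<chi> r. fps_to_fls (v $ r)) $$ (3 * int m + 1) = fps_nth (v $ 2) m"
  "E3_of_vec (\<chi> r. fps_to_fls (v $ r)) $$ (3 * int m) = fps_nth (v $ 3) m"
  by (simp_all add: E3_of_vec_nth)

text \<open>Coefficient m of coordinates 1, 2, 3 sits at exponent 3 m + 2, 3 m + 1, 3 m in E_3; the
  inequalities put the exponent for m = k - 1 below d.\<close>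

lemma dvd_of_E3_subdegree:
  fixes v :: "'a::field fps ^3"
  assumes "fls_subdegree (E3_of_vec (\<chi> r. fps_to_fls (v $ r))) = int d"
  shows "3 * k < d + 3 \<Longrightarrow> fps_X ^ k dvd v $ 3" "3 * k < d + 2 \<Longrightarrow> fps_X ^ k dvd v $ 2"
    "3 * k < d + 1 \<Longrightarrow> fps_X ^ k dvd v $ 1"
proof -
  let ?f = "E3_of_vec (\<chi> r. fps_to_fls (v $ r))"
  have 0: "?f $$ n = 0" if "n < int d" for n
    by (rule fls_eq0_below_subdegree) (simp add: assms that)
  show "3 * k < d + 3 \<Longrightarrow> fps_X ^ k dvd v $ 3" "3 * k < d + 2 \<Longrightarrow> fps_X ^ k dvd v $ 2"
    "3 * k < d + 1 \<Longrightarrow> fps_X ^ k dvd v $ 1"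
    unfolding fps_X_power_dvd_iff by (auto simp flip: E3_nth_map(3), auto simp flip: E3_nth_map(2), auto simp flip: E3_nth_map(1) intro!: 0)
qed

lemma column_map_matrix:
  "column l (map_matrix fps_to_fls H) = (\<chi> r. fps_to_fls (column l H $ r))"
  by (simp add: vec_eq_iff column_def)

lemma det_lattice_basis:
  "det (lattice_basis t i j x y z) = (if t then 1 else - 1) * fps_X ^ (2 * i + j + of_bool t)"
proof -
  have "fps_X ^ (2 * i + j + of_bool t) = (fps_X ^ i * fps_X ^ (i + j + of_bool t) :: 'a fps)"
    by (simp only: power_add[symmetric] mult_2 add.assoc)
  then show ?thesis
    by (simp only:) (cases t; simp add: det_3 lattice_basis_def vector_3 mult_ac)
qed

text \<open>The residues of B and C decide the type. With the parameters from
  \<open>exists_reduced_coeffs\<close> all columns of H pass \<open>in_lattice\<close>, so H = R K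
  for the reduced basis R; as det H and det R have the same valuation, det K is a unit.\<close>

lemma exists_lattice_basis:
  fixes H :: "'k::field fps ^3^3"
  assumes nz: "column 1 H \<noteq> 0"
    and val: "col_val (map_matrix fps_to_fls H) 1 = 0" "col_val (map_matrix fps_to_fls H) 2 = int B"
      "col_val (map_matrix fps_to_fls H) 3 = int C"
    and BC: "0 < B" "B < C" "B mod 3 \<noteq> 0" "C mod 3 \<noteq> 0" "B mod 3 \<noteq> C mod 3"
  obtains t i j x y z K where "x \<in> fps_trunc i" "y \<in> fps_trunc (i + j + of_bool t)" "z \<in> fps_trunc j"
    "invertible K" "H = lattice_basis t i j x y z ** K"
proof -
  have val: "fls_subdegree (E3_of_vec (\<chi> r. fps_to_fls (column 1 H $ r))) = int 0"
    "fls_subdegree (E3_of_vec (\<chi> r. fps_to_fls (column 2 H $ r))) = int B"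
    "fls_subdegree (E3_of_vec (\<chi> r. fps_to_fls (column 3 H $ r))) = int C"
    using val by (simp_all add: column_map_matrix)
  note dvd = dvd_of_E3_subdegree[OF val(1)] dvd_of_E3_subdegree[OF val(2)] dvd_of_E3_subdegree[OF val(3)]
  have "E3_of_vec (\<chi> r. fps_to_fls (column 1 H $ r)) \<noteq> 0"
    using nz by (simp add: vec_eq_iff)
  moreover have "E3_of_vec (\<chi> r. fps_to_fls (column 2 H $ r)) \<noteq> 0"
    "E3_of_vec (\<chi> r. fps_to_fls (column 3 H $ r)) \<noteq> 0"
    using val BC by auto
  ultimately have piv: "E3_of_vec (\<chi> r. fps_to_fls (column 1 H $ r)) $$ 0 \<noteq> 0"
    "E3_of_vec (\<chi> r. fps_to_fls (column 2 H $ r)) $$ int B \<noteq> 0"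
    "E3_of_vec (\<chi> r. fps_to_fls (column 3 H $ r)) $$ int C \<noteq> 0"
    using nth_fls_subdegree_nonzero val by (metis of_nat_0)+
  define p q r where "p = H $ 3 $ 1" and "q = H $ 2 $ 1" and "r = H $ 1 $ 1"
  have p: "fps_nth p 0 \<noteq> 0"
    using piv(1) E3_nth_map(3)[of "column 1 H" 0] by (simp add: p_def column_def)
  have det_K: "invertible K" if "H = R ** K" "det R = u * fps_X ^ m" "det H = fps_X ^ m * W" "fps_nth W 0 \<noteq> 0"
    for R K u m W
  proof (rule invertible_3)
    have "fps_X ^ m * W = fps_X ^ m * (u * det K)"
      using that(1-3) by (simp add: det_mul)
    then have "W = u * det K" by simp
    then have "fps_nth u 0 * fps_nth (det K) 0 \<noteq> 0" using that(4) by (simp add: fps_mult_nth_0)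
    then show "det K dvd 1" by simp
  qed
  consider "B mod 3 = 1" "C mod 3 = 2" | "B mod 3 = 2" "C mod 3 = 1" using BC(3-5) by linarith
  then show thesis
  proof cases
    case 1
    define i j where "i = B div 3" and "j = C div 3 - B div 3"
    have ij: "B = 3 * i + 1" "C = 3 * (i + j) + 2"
    proof -
      have "B = 3 * (B div 3) + 1" "C = 3 * (C div 3) + 2"
        using 1 div_mult_mod_eq[of B 3] div_mult_mod_eq[of C 3] by simp_all
      moreover from this have "B div 3 \<le> C div 3" using \<open>B < C\<close> by linarith
      ultimately show "B = 3 * i + 1" "C = 3 * (i + j) + 2" by (simp_all add: i_def j_def)
    qed
    have "fps_X ^ i dvd H $ 2 $ 2" "fps_X ^ i dvd H $ 1 $ 2" "fps_X ^ (i + 1) dvd H $ 3 $ 2"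
      "fps_X ^ (i + j) dvd H $ 1 $ 3" "fps_X ^ (i + j + 1) dvd H $ 2 $ 3" "fps_X ^ (i + j + 1) dvd H $ 3 $ 3"
      using dvd(4)[of "i + 1"] dvd(5)[of i] dvd(6)[of i] dvd(7)[of "i + j + 1"] dvd(8)[of "i + j + 1"]
        dvd(9)[of "i + j"] unfolding ij by (simp_all add: column_def)
    then obtain p' q' r' p'' q'' r'' where H: "H $ 2 $ 2 = fps_X ^ i * q'" "H $ 1 $ 2 = fps_X ^ i * r'"
      "H $ 3 $ 2 = fps_X ^ (i + 1) * p'" "H $ 1 $ 3 = fps_X ^ (i + j) * r''"
      "H $ 2 $ 3 = fps_X ^ (i + j + 1) * q''" "H $ 3 $ 3 = fps_X ^ (i + j + 1) * p''"
      by (elim dvdE) blast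
    have q': "fps_nth q' 0 \<noteq> 0"
      using piv(2) E3_nth_map(2)[of "column 2 H" i]
      by (simp add: ij column_def H fps_X_power_mult_nth add.commute)
    have r'': "fps_nth r'' 0 \<noteq> 0"
    proof -
      have C: "int C = 3 * int (i + j) + 2" using ij by simp
      show ?thesis
        using piv(3)[unfolded C E3_nth_map(1)] by (simp add: column_def H fps_X_power_mult_nth)
    qed
    obtain x y z where xyz: "x \<in> fps_trunc i" "y \<in> fps_trunc (i + j + 0)" "z \<in> fps_trunc j"
      and x: "fps_X ^ i dvd q - p * x"
      and y: "fps_X ^ (i + j + 0) dvd r - p * y - (q - p * x) * (fps_X ^ 0 * z)"
      and z: "fps_X ^ j dvd r' - fps_X * p' * y - (q' - fps_X * p' * x) * z"
      using exists_reduced_coeffs[OF p q', of 0 "fps_X * p'" p' i j q r r'] by auto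
    have c2eq: "H $ 1 $ 2 - H $ 3 $ 2 * y - (H $ 2 $ 2 - H $ 3 $ 2 * x) * z =
        fps_X ^ i * (r' - fps_X * p' * y - (q' - fps_X * p' * x) * z)"
      by (simp add: H algebra_simps)
    have c2: "in_lattice False i j x y z (column 2 H)"
      unfolding in_lattice_False column_def vec_lambda_beta c2eq using z
      by (simp add: H power_add mult.assoc)
    have c1: "in_lattice False i j x y z (column 1 H)"
      unfolding in_lattice_False using x y by (simp add: column_def p_def q_def r_def)
    have c3: "in_lattice False i j x y z (column 3 H)"
      unfolding in_lattice_False by (simp add: column_def H power_add mult.assoc dvd_diff)
    obtain K where K: "H = lattice_basis False i j x y z ** K"
      using c1 c2 c3 matrix_factor_iff[of H "lattice_basis False i j x y z"]
      by (auto simp: forall_3 simp flip: in_lattice_iff)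
    have e: "(fps_X :: 'k fps) ^ (2 * i + j + of_bool False) = fps_X ^ i * fps_X ^ i * fps_X ^ j"
      by (simp add: power_add mult_2)
    \<comment> \<open>Modulo \<epsilon> the cofactor is minus the product of the pivots p, q', r'';
      every other term carries a factor \<epsilon>.\<close>
    have "det H = fps_X ^ (2 * i + j + of_bool False) * (r * (q' * fps_X * p'' - fps_X * q'' * fps_X * p')
        - r' * (q * fps_X * p'' - p * fps_X * q'') + r'' * (q * fps_X * p' - q' * p))"
      unfolding det_3 H e p_def q_def r_def unfolding power_add power_one_right by algebra
    then have "invertible K"
      by (rule det_K[OF K det_lattice_basis]) (use p q' r'' in \<open>simp add: mult.assoc fps_mult_nth_0\<close>)
    then show thesis using xyz K by (intro that[of x i y j False z K]) auto
  next
    case 2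
    \<comment> \<open>Residues 2 and 1 with B < C force \<open>B div 3 < C div 3\<close>, so the
      natural subtraction in j is exact.\<close>
    define i j where "i = B div 3" and "j = C div 3 - B div 3 - 1"
    have ij: "B = 3 * i + 2" "C = 3 * (i + j + 1) + 1"
    proof -
      have "B = 3 * (B div 3) + 2" "C = 3 * (C div 3) + 1"
        using 2 div_mult_mod_eq[of B 3] div_mult_mod_eq[of C 3] by simp_all
      moreover from this have "B div 3 + 1 \<le> C div 3" using \<open>B < C\<close> by linarith
      ultimately show "B = 3 * i + 2" "C = 3 * (i + j + 1) + 1" by (simp_all add: i_def j_def)
    qed
    have "fps_X ^ i dvd H $ 1 $ 2" "fps_X ^ (i + 1) dvd H $ 2 $ 2" "fps_X ^ (i + 1) dvd H $ 3 $ 2"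
      "fps_X ^ (i + j + 1) dvd H $ 1 $ 3" "fps_X ^ (i + j + 1) dvd H $ 2 $ 3" "fps_X ^ (i + j + 2) dvd H $ 3 $ 3"
      using dvd(4)[of "i + 1"] dvd(5)[of "i + 1"] dvd(6)[of i] dvd(7)[of "i + j + 2"] dvd(8)[of "i + j + 1"]
        dvd(9)[of "i + j + 1"] unfolding ij by (simp_all add: column_def)
    then obtain p' q' r' p'' q'' r'' where H: "H $ 1 $ 2 = fps_X ^ i * q'" "H $ 2 $ 2 = fps_X ^ (i + 1) * r'"
      "H $ 3 $ 2 = fps_X ^ (i + 1) * p'" "H $ 2 $ 3 = fps_X ^ (i + j + 1) * r''"
      "H $ 1 $ 3 = fps_X ^ (i + j + 1) * q''" "H $ 3 $ 3 = fps_X ^ (i + j + 2) * p''"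
      by (elim dvdE) blast
    have q': "fps_nth q' 0 \<noteq> 0"
      using piv(2) E3_nth_map(1)[of "column 2 H" i]
      by (simp add: ij column_def H fps_X_power_mult_nth add.commute)
    have r'': "fps_nth r'' 0 \<noteq> 0"
    proof -
      have C: "int C = 3 * int (i + j + 1) + 1" using ij by simp
      show ?thesis
        using piv(3)[unfolded C E3_nth_map(2)]
        by (simp add: column_def H fps_X_power_mult_nth del: add_Suc_right power_Suc add_2_eq_Suc')
    qed
    \<comment> \<open>Here the second pivot lies in the coordinate s^2 and the third in s, so q and
      r change places in \<open>exists_reduced_coeffs\<close>.\<close>
    obtain x y z where xyz: "x \<in> fps_trunc i" "y \<in> fps_trunc (i + j + 1)" "z \<in> fps_trunc j"
      and x: "fps_X ^ i dvd r - p * x"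
      and y: "fps_X ^ (i + j + 1) dvd q - p * y - (r - p * x) * (fps_X ^ 1 * z)"
      and z: "fps_X ^ j dvd r' - p' * y - (q' - fps_X * p' * x) * z"
      using exists_reduced_coeffs[OF p q', of 1 p' p' i j r q r'] by auto
    have c2eq: "H $ 2 $ 2 - H $ 3 $ 2 * y - (H $ 1 $ 2 - H $ 3 $ 2 * x) * (fps_X * z) =
        fps_X ^ (i + 1) * (r' - p' * y - (q' - fps_X * p' * x) * z)"
      by (simp add: H algebra_simps)
    have c2: "in_lattice True i j x y z (column 2 H)"
      unfolding in_lattice_True column_def vec_lambda_beta c2eq using z
      by (simp add: H power_add mult.assoc)
    have c1: "in_lattice True i j x y z (column 1 H)"
      unfolding in_lattice_True using x y by (simp add: column_def p_def q_def r_def)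
    have c3: "in_lattice True i j x y z (column 3 H)"
      unfolding in_lattice_True by (simp add: column_def H power_add mult.assoc dvd_diff)
    obtain K where K: "H = lattice_basis True i j x y z ** K"
      using c1 c2 c3 matrix_factor_iff[of H "lattice_basis True i j x y z"]
      by (auto simp: forall_3 simp flip: in_lattice_iff)
    have e: "(fps_X :: 'k fps) ^ (2 * i + j + of_bool True) = fps_X ^ i * fps_X ^ i * fps_X ^ j * fps_X"
      by (simp add: power_add mult_2)
    have "det H = fps_X ^ (2 * i + j + of_bool True) * (r * (fps_X * r' * fps_X * p'' - r'' * fps_X * p')
        - q' * (q * fps_X * p'' - p * r'') + q'' * (q * fps_X * p' - fps_X * r' * p))"
      unfolding det_3 H e p_def q_def r_def unfolding power_add power_one_right by algebra
    then have "invertible K"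
      by (rule det_K[OF K det_lattice_basis]) (use p q' r'' in \<open>simp add: mult.assoc fps_mult_nth_0\<close>)
    then show thesis using xyz K by (intro that[of x i y j True z K]) auto
  qed
qed

section \<open>The affine Springer fiber\<close>

lemma matrix_inv_mult:
  fixes g :: "'a::semiring_1 ^'n^'n"
  assumes "invertible g"
  shows "g ** matrix_inv g = mat 1" "matrix_inv g ** g = mat 1"
  using someI_ex[OF assms[unfolded invertible_def]] unfolding matrix_inv_def by auto

lemma invertible_matrix_inv:
  fixes g :: "'a::semiring_1 ^'n^'n"
  shows "invertible g \<Longrightarrow> invertible (matrix_inv g)"
  using matrix_inv_mult unfolding invertible_def by blast

lemma matrix_inv_matrix_inv:
  fixes g :: "'a::semiring_1 ^'n^'n"
  assumes "invertible g"
  shows "matrix_inv (matrix_inv g) = g"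
  using matrix_inv_mult[OF assms] matrix_inv_mult[OF invertible_matrix_inv[OF assms]]
  by (metis matrix_mul_assoc matrix_mul_lid matrix_mul_rid)

text \<open>\<open>Ad (matrix_inv g) \<gamma>\<close> is the matrix of \<gamma> in the basis of the
  columns of g; its integrality is the \<gamma>-stability of the lattice they span.\<close>

lemma Ad_inv_in_gl_O_iff:
  assumes "invertible g"
  shows "Ad (matrix_inv g) \<gamma> \<in> gl_O \<longleftrightarrow> (\<exists>N\<in>gl_O. \<gamma> ** g = g ** N)"
proof -
  have "\<gamma> ** g = g ** (matrix_inv g ** \<gamma> ** g)"
    using matrix_inv_mult(1)[OF assms] by (simp add: matrix_mul_assoc)
  moreover have "N = matrix_inv g ** \<gamma> ** g" if "\<gamma> ** g = g ** N" for N
    using that matrix_inv_mult(2)[OF assms] by (metis matrix_mul_assoc matrix_mul_lid)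
  ultimately show ?thesis
    using assms by (auto simp: Ad_def matrix_inv_matrix_inv)
qed

lemma carrier_GL: "carrier GL = {A. invertible A}"
  and mult_GL: "g \<otimes>\<^bsub>GL\<^esub> h = g ** h"
  by (simp_all add: GL_def)

lemma l_coset_GL: "g <#\<^bsub>GL\<^esub> H = (\<lambda>h. g ** h) ` H"
  by (auto simp: l_coset_def GL_def)

lemma mat_1_in_GL_O: "(mat 1 :: 'k::field fls ^3^3) \<in> GL_O"
  using GL_O_I[of "mat 1"] by (simp add: map_matrix_1)

lemma coset_mult_GL_O:
  fixes k :: "'k::field fls ^3^3"
  assumes k: "k \<in> GL_O"
  shows "(g ** k) <#\<^bsub>GL\<^esub> GL_O = g <#\<^bsub>GL\<^esub> GL_O"
proof -
  obtain l where l: "l \<in> GL_O" "k ** l = mat 1" using GL_O_inverse[OF k] by metis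
  have "h \<in> (\<lambda>m. k ** m) ` GL_O" if "h \<in> GL_O" for h
    by (rule image_eqI[of _ _ "l ** h"]) (simp_all add: matrix_mul_assoc l that GL_O_mult)
  then have "(\<lambda>m. k ** m) ` GL_O = GL_O" using GL_O_mult[OF k] by blast
  then have "(\<lambda>m. g ** m) ` (\<lambda>m. k ** m) ` GL_O = (\<lambda>m. g ** m) ` GL_O" by simp
  then show ?thesis by (simp add: l_coset_GL image_image matrix_mul_assoc)
qed

lemma coset_eq_GL_O_D:
  fixes g h :: "'k::field fls ^3^3"
  assumes "g <#\<^bsub>GL\<^esub> GL_O = h <#\<^bsub>GL\<^esub> GL_O"
  obtains k where "k \<in> GL_O" "g = h ** k"
proof -
  have "g \<in> g <#\<^bsub>GL\<^esub> GL_O"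
    unfolding l_coset_GL by (rule image_eqI[OF _ mat_1_in_GL_O]) simp
  then show thesis using that assms by (auto simp: l_coset_GL)
qed

text \<open>Undoing the change of basis by k replaces N by \<open>k ** N ** l\<close> with l the
  inverse of k, which is again integral.\<close>

lemma stable_mult_GL_O:
  fixes g k \<gamma> :: "'k::field fls ^3^3"
  assumes k: "k \<in> GL_O" and st: "\<exists>N\<in>gl_O. \<gamma> ** (g ** k) = g ** k ** N"
  shows "\<exists>N\<in>gl_O. \<gamma> ** g = g ** N"
proof -
  obtain l where l: "l \<in> GL_O" "k ** l = mat 1" using GL_O_inverse[OF k] by metis
  obtain N where N: "N \<in> gl_O" "\<gamma> ** (g ** k) = g ** k ** N" using st by blast
  obtain A B C where "k = map_matrix fps_to_fls A" "N = map_matrix fps_to_fls B" "l = map_matrix fps_to_fls C"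
    using k l(1) N(1) by (auto simp: GL_O_def gl_O_def)
  then have "k ** N ** l = map_matrix fps_to_fls (A ** B ** C)" by (simp add: map_matrix_mult)
  then have "k ** N ** l \<in> gl_O" by (simp add: gl_O_def)
  moreover have "\<gamma> ** (g ** k) ** l = g ** k ** N ** l" using N(2) by simp
  then have "\<gamma> ** (g ** (k ** l)) = g ** (k ** N ** l)" by (simp only: matrix_mul_assoc)
  then have "\<gamma> ** g = g ** (k ** N ** l)" by (simp add: l(2))
  ultimately show ?thesis by blast
qed

text \<open>The definition speaks of some representative of the coset; by
  \<open>stable_mult_GL_O\<close> stability may be tested on g itself.\<close>

lemma springer_fiber0_eq:
  fixes \<gamma> :: "'k::field fls ^3^3"
  shows "springer_fiber0 \<gamma> = {g <#\<^bsub>GL\<^esub> GL_O | g. invertible g \<and> (\<exists>N\<in>gl_O. \<gamma> ** g = g ** N) \<and>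
     fls_subdegree (det g) = 0}"
proof -
  have "g <#\<^bsub>GL\<^esub> GL_O \<in> springer_fiber \<gamma> \<longleftrightarrow> (\<exists>N\<in>gl_O. \<gamma> ** g = g ** N)" if g: "invertible g" for g
  proof
    assume "g <#\<^bsub>GL\<^esub> GL_O \<in> springer_fiber \<gamma>"
    then obtain h where h: "g <#\<^bsub>GL\<^esub> GL_O = h <#\<^bsub>GL\<^esub> GL_O" "invertible h" "Ad (matrix_inv h) \<gamma> \<in> gl_O"
      unfolding springer_fiber_def carrier_GL by auto
    then have "\<exists>N\<in>gl_O. \<gamma> ** h = h ** N" using Ad_inv_in_gl_O_iff[OF h(2)] by simp
    with h(1) show "\<exists>N\<in>gl_O. \<gamma> ** g = g ** N" by (metis coset_eq_GL_O_D stable_mult_GL_O)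
  next
    assume "\<exists>N\<in>gl_O. \<gamma> ** g = g ** N"
    then show "g <#\<^bsub>GL\<^esub> GL_O \<in> springer_fiber \<gamma>"
      unfolding springer_fiber_def carrier_GL using g Ad_inv_in_gl_O_iff[OF g] by auto
  qed
  then show ?thesis unfolding springer_fiber0_def carrier_GL by auto
qed

text \<open>The power of \<open>s\<close> makes the determinant a unit.\<close>

definition lattice_rep :: "bool \<times> nat \<times> nat \<times> 'k::field fps \<times> 'k fps \<times> 'k fps \<Rightarrow> 'k fls ^3^3" where
  "lattice_rep = (\<lambda>(t, i, j, x, y, z). E3_mult (fls_X_intpow (- int (2 * i + j + of_bool t)))
     ** map_matrix fps_to_fls (lattice_basis t i j x y z))"

lemma det_map_matrix: "det (map_matrix fps_to_fls (A :: 'k::field fps ^3^3)) = fps_to_fls (det A)"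
  by (simp add: det_3 fls_times_fps_to_fls)

lemma det_lattice_basis_subdegree:
  "det (lattice_basis t i j x y z) \<noteq> 0"
  "subdegree (det (lattice_basis t i j x y z)) = 2 * i + j + of_bool t"
  by (cases t; simp add: det_lattice_basis)+

lemma lattice_rep_invertible:
  shows "invertible (lattice_rep p)" "fls_subdegree (det (lattice_rep p)) = 0"
proof -
  obtain t i j x y z where p: "p = (t, i, j, x, y, z)" by (metis prod.collapse)
  define m where "m = int (2 * i + j + of_bool t)"
  have "det (E3_mult (fls_X_intpow (- m) :: 'a fls)) \<noteq> 0"
    using invertible_E3_mult[of "fls_X_intpow (- m)"] by (simp add: invertible_det_nz fls_shift_eq0_iff)
  moreover have "fls_subdegree (det (E3_mult (fls_X_intpow (- m) :: 'a fls))) = - m"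
    by (subst subdegree_det_E3_mult) (simp_all add: fls_shift_eq0_iff)
  moreover have "det (lattice_rep p) =
      det (E3_mult (fls_X_intpow (- m))) * fps_to_fls (det (lattice_basis t i j x y z))"
    by (simp only: p lattice_rep_def det_mul det_map_matrix m_def prod.case)
  ultimately show "invertible (lattice_rep p)" "fls_subdegree (det (lattice_rep p)) = 0"
    by (simp_all add: invertible_det_nz det_lattice_basis_subdegree fls_subdegree_fls_to_fps m_def)
qed

text \<open>A power of s moves the smallest column valuation to 0, after which
  \<open>exists_lattice_basis\<close> applies; the valuation of the determinant then determines that
  power.\<close>

lemma exists_lattice_rep:
  fixes g :: "'k::field fls ^3^3"
  assumes g: "invertible g" "fls_subdegree (det g) = 0"
  obtains t i j x y z k where "x \<in> fps_trunc i" "y \<in> fps_trunc (i + j + of_bool t)" "z \<in> fps_trunc j"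
    "k \<in> GL_O" "g = lattice_rep (t, i, j, x, y, z) ** k"
proof -
  obtain k where k: "k \<in> GL_O" and inj: "inj (\<lambda>j. col_val (g ** k) j mod 3)"
    and less: "col_val (g ** k) 1 < col_val (g ** k) 2" "col_val (g ** k) 2 < col_val (g ** k) 3"
    using exists_sorted_columns[OF g(1)] .
  define a where "a = col_val (g ** k) 1"
  have inv: "invertible (g ** k)" using g(1) k by (simp add: invertible_mult GL_O_invertible)
  let ?s = "fls_X_intpow (- a) :: 'k fls"
  define h where "h = E3_mult ?s ** (g ** k)"
  have E3_h: "E3_of_vec (column l h) = fls_shift a (E3_of_vec (column l (g ** k)))" for l
    unfolding h_def column_mult[of _ "E3_mult _"] E3_of_vec_E3_mult fls_X_intpow_times_conv_shift(1)
    by simp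
  have nz: "E3_of_vec (column l (g ** k)) \<noteq> 0" for l
    using column_nonzero[OF inv] by simp
  then have val_h: "col_val h l = col_val (g ** k) l - a" for l
    by (simp add: E3_h)
  have "0 \<le> col_val h l" for l
    using exhaust_3[of l] less unfolding val_h a_def by auto
  then have "E3_of_vec (column l h) \<in> range fps_to_fls" for l
    unfolding range_fps_to_fls_iff by (metis fls_eq0_below_subdegree less_le_trans)
  then have "\<forall>i l. \<exists>y. h $ i $ l = fps_to_fls y"
    unfolding E3_of_vec_integral_iff column_def by auto
  then obtain y where "\<And>i l. h $ i $ l = fps_to_fls (y i l)" by metis
  then have "h = map_matrix fps_to_fls (\<chi> i l. y i l)" by (simp add: vec_eq_iff)
  then obtain H where H: "h = map_matrix fps_to_fls H" ..
  have mod: "col_val (g ** k) 1 mod 3 \<noteq> col_val (g ** k) 2 mod 3"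
    "col_val (g ** k) 1 mod 3 \<noteq> col_val (g ** k) 3 mod 3"
    "col_val (g ** k) 2 mod 3 \<noteq> col_val (g ** k) 3 mod 3"
    using inj by (auto dest!: injD)
  define B C where "B = nat (col_val h 2)" and "C = nat (col_val h 3)"
  have BC: "col_val h 2 = int B" "col_val h 3 = int C" "0 < B" "B < C"
    using less by (simp_all add: B_def C_def val_h a_def)
  have "int B = col_val (g ** k) 2 - col_val (g ** k) 1" "int C = col_val (g ** k) 3 - col_val (g ** k) 1"
    "int B - int C = col_val (g ** k) 2 - col_val (g ** k) 3"
    unfolding BC(1,2)[symmetric] val_h a_def by simp_all
  then have "\<not> 3 dvd int B" "\<not> 3 dvd int C" "\<not> 3 dvd int B - int C"
    using mod by (simp_all only: mod_eq_dvd_iff[symmetric]) metis+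
  then have BC_mod: "B mod 3 \<noteq> 0" "C mod 3 \<noteq> 0" "B mod 3 \<noteq> C mod 3"
    by presburger+
  have "column 1 h \<noteq> 0" using nz[of 1] E3_h[of 1] by (metis E3_of_vec_zero fls_shift_eq0_iff)
  then have "column 1 H \<noteq> 0" by (auto simp: H column_map_matrix vec_eq_iff)
  moreover have "col_val h 1 = 0" by (simp add: val_h a_def)
  ultimately obtain t i j x y z K where xyz: "x \<in> fps_trunc i" "y \<in> fps_trunc (i + j + of_bool t)" "z \<in> fps_trunc j"
    and K: "invertible K" "H = lattice_basis t i j x y z ** K"
    using exists_lattice_basis[of H B C] BC BC_mod unfolding H by metis
  have K_O: "map_matrix fps_to_fls K \<in> GL_O" using K(1) by (auto simp: GL_O_def)
  obtain k' where k': "k' \<in> GL_O" "k ** k' = mat 1" using GL_O_inverse[OF k] by metis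
  have s: "E3_mult (fls_X_intpow a) ** E3_mult (fls_shift a 1 :: 'k fls) = mat 1"
    by (simp flip: E3_mult_mult add: fls_X_intpow_times_conv_shift)
  have "E3_mult (fls_X_intpow a) ** h ** k' = E3_mult (fls_X_intpow a) ** E3_mult ?s ** g ** (k ** k')"
    by (simp add: h_def matrix_mul_assoc)
  then have g_eq: "g = E3_mult (fls_X_intpow a) ** map_matrix fps_to_fls (lattice_basis t i j x y z)
      ** (map_matrix fps_to_fls K ** k')"
    by (simp add: s k' H K(2) map_matrix_mult matrix_mul_assoc)
  \<comment> \<open>The three factors in \<open>g_eq\<close> have determinants of valuation a, 2 i +
    j + \<open>of_bool t\<close> and 0, and the product has valuation 0.\<close>
  have "a + int (2 * i + j + of_bool t) = 0"
  proof -
    have kk: "map_matrix fps_to_fls K ** k' \<in> GL_O" using K_O k'(1) by (rule GL_O_mult)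
    have "det (E3_mult (fls_X_intpow a :: 'k fls)) \<noteq> 0"
      using invertible_E3_mult[of "fls_X_intpow a :: 'k fls"] by (simp add: invertible_det_nz)
    then show ?thesis
      using g(2) det_GL_O[OF kk] unfolding g_eq
      by (simp add: det_mul det_map_matrix det_lattice_basis_subdegree subdegree_det_E3_mult
          fls_subdegree_fls_to_fps)
  qed
  then have "a = - int (2 * i + j + of_bool t)" by simp
  then have "g = lattice_rep (t, i, j, x, y, z) ** (map_matrix fps_to_fls K ** k')"
    using g_eq by (simp add: lattice_rep_def)
  with xyz GL_O_mult[OF K_O k'(1)] show thesis by (intro that)
qed


text \<open>Mutual inclusion lets the columns of each basis be tested against the other lattice.
  This compares first the types, then the pivot exponents, then x, y and z, which are congruent
  modulo their truncation bounds.\<close>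

lemma lattice_basis_eq_D:
  fixes x y z x' y' z' :: "'k::field fps"
  assumes trunc: "x \<in> fps_trunc i" "y \<in> fps_trunc (i + j + of_bool t)" "z \<in> fps_trunc j"
      "x' \<in> fps_trunc i'" "y' \<in> fps_trunc (i' + j' + of_bool t')" "z' \<in> fps_trunc j'"
    and eq: "lattice_basis t' i' j' x' y' z' = lattice_basis t i j x y z ** K"
      "lattice_basis t i j x y z = lattice_basis t' i' j' x' y' z' ** K'"
  shows "(t', i', j', x', y', z') = (t, i, j, x, y, z)"
proof -
  have in1: "in_lattice t i j x y z (column l (lattice_basis t' i' j' x' y' z'))" for l
    unfolding in_lattice_iff using eq(1) by (metis column_mult)
  have in2: "in_lattice t' i' j' x' y' z' (column l (lattice_basis t i j x y z))" for l
    unfolding in_lattice_iff using eq(2) by (metis column_mult)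
  have pw: "(fps_X :: 'k fps) ^ k dvd fps_X ^ m \<longleftrightarrow> k \<le> m" for k m
    using fps_X_power_dvd_mult_unit[of "1 :: 'k fps" k m] by simp
  note cols = column_def lattice_basis_def vector_3
  \<comment> \<open>The second columns already contradict each other: their tests give i + j <= i'
    and i' + j' + 1 <= i.\<close>
  have no: False if "\<And>l. in_lattice False i j x y z (column l (lattice_basis True i' j' x' y' z'))"
    "\<And>l. in_lattice True i' j' x' y' z' (column l (lattice_basis False i j x y z))"
    for i j i' j' and x y z x' y' z' :: "'k fps"
  proof -
    have "fps_X ^ (i + j) dvd fps_X ^ i' * (1 - fps_X * (z' * z))"
      using that(1)[of 2] by (simp add: in_lattice_False cols algebra_simps)
    then have "i + j \<le> i'"
      using fps_X_power_dvd_mult_unit[of "1 - fps_X * (z' * z)" "i + j" i'] by simp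
    moreover have "fps_X ^ (i' + j' + 1) dvd fps_X ^ i * (1 - fps_X * (z * z'))"
      using that(2)[of 2] by (simp add: in_lattice_True cols algebra_simps)
    then have "i' + j' + 1 \<le> i"
      using fps_X_power_dvd_mult_unit[of "1 - fps_X * (z * z')" "i' + j' + 1" i] by simp
    ultimately show False by simp
  qed
  have t: "t' = t"
    using no[of i j x y z i' j' x' y' z'] no[of i' j' x' y' z' i j x y z] in1 in2 by (cases t; cases t') auto
  have "i = i' \<and> j = j'"
  proof (cases t)
    case True
    then show ?thesis
      using in1[of 2] in1[of 3] in2[of 2] in2[of 3] unfolding t
      by (simp add: in_lattice_True cols pw del: power_Suc flip: power_Suc)
  next
    case False
    then show ?thesis
      using in1[of 2] in1[of 3] in2[of 2] in2[of 3] unfolding t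
      by (simp add: in_lattice_False cols pw)
  qed
  then have ij: "i' = i" "j' = j" by simp_all
  have x: "x' = x"
    using in1[of 1] trunc unfolding t ij
    by (intro fps_trunc_eqI[of x' i x]) (cases t; simp add: in_lattice_True in_lattice_False cols)+
  have y: "y' = y"
    using in1[of 1] trunc unfolding t ij x
    by (intro fps_trunc_eqI[of y' "i + j + of_bool t" y])
      (cases t; simp add: in_lattice_True in_lattice_False cols)+
  \<comment> \<open>With all other data equal, the test of the second column only involves the
    difference of z' and z.\<close>
  have "fps_X ^ (i + j + of_bool t) dvd fps_X ^ (i + of_bool t) * (z' - z)"
    using in1[of 2] unfolding t ij x y
    by (cases t) (simp_all add: in_lattice_True in_lattice_False cols algebra_simps)
  moreover have "(fps_X :: 'k fps) ^ (i + j + of_bool t) = fps_X ^ (i + of_bool t) * fps_X ^ j"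
    by (simp add: power_add)
  ultimately have "fps_X ^ j dvd z' - z" by (simp only: dvd_mult_cancel_left) simp
  then have "z' = z" using trunc unfolding ij by (intro fps_trunc_eqI[of z' j z])
  with t ij x y show ?thesis by simp
qed

text \<open>The equation says that R' is s^(m' - m) times the integral matrix R K. The first column
  of R' has coefficient 1 at s^0, which excludes m' > m; for m' = m the power of s disappears.
  Applied in both directions this gives m' = m.\<close>

lemma lattice_rep_eq_D:
  fixes k :: "'k::field fls ^3^3"
  assumes k: "k \<in> GL_O" and eq: "lattice_rep (t', i', j', x', y', z') = lattice_rep (t, i, j, x, y, z) ** k"
  defines "m \<equiv> int (2 * i + j + of_bool t)" and "m' \<equiv> int (2 * i' + j' + of_bool t')"
  shows "m' \<le> m" "m' = m \<Longrightarrow> \<exists>K. lattice_basis t' i' j' x' y' z' = lattice_basis t i j x y z ** K"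
proof -
  let ?R = "lattice_basis t i j x y z" and ?R' = "lattice_basis t' i' j' x' y' z'"
  obtain K where K: "k = map_matrix fps_to_fls K" using k by (auto simp: GL_O_def)
  have "E3_mult (fls_X_intpow (- m')) ** map_matrix fps_to_fls ?R' =
      E3_mult (fls_X_intpow (- m)) ** map_matrix fps_to_fls ?R ** k"
    using eq by (simp only: lattice_rep_def prod.case m_def m'_def)
  then have "E3_mult (fls_X_intpow m') ** E3_mult (fls_X_intpow (- m')) ** map_matrix fps_to_fls ?R' =
      E3_mult (fls_X_intpow m') ** E3_mult (fls_X_intpow (- m)) ** map_matrix fps_to_fls (?R ** K)"
    by (simp only: K map_matrix_mult flip: matrix_mul_assoc)
  then have *: "map_matrix fps_to_fls ?R' = E3_mult (fls_X_intpow (m' - m)) ** map_matrix fps_to_fls (?R ** K)"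
    by (simp only: fls_X_intpow_times_fls_X_intpow flip: E3_mult_mult) simp
  show "m' \<le> m"
  proof (rule ccontr)
    assume "\<not> m' \<le> m"
    have "E3_of_vec (column 1 (map_matrix fps_to_fls ?R')) $$ 0 = 1"
      by (simp add: E3_of_vec_nth column_def lattice_basis_def vector_3)
    moreover have "E3_of_vec (column 1 (map_matrix fps_to_fls (?R ** K))) \<in> range fps_to_fls"
      unfolding E3_of_vec_integral_iff by (simp add: column_def)
    then have "E3_of_vec (column 1 (map_matrix fps_to_fls (?R ** K))) $$ (m - m') = 0"
      using \<open>\<not> m' \<le> m\<close> unfolding range_fps_to_fls_iff by auto
    then have "E3_of_vec (column 1 (map_matrix fps_to_fls ?R')) $$ 0 = 0"
      unfolding * column_mult[of _ "E3_mult _"] E3_of_vec_E3_mult fls_X_intpow_times_conv_shift(1)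
      by simp
    ultimately show False by simp
  qed
  show "\<exists>K. ?R' = ?R ** K" if "m' = m"
    using * that by (auto simp: map_matrix_inject)
qed

lemma lattice_rep_coset_inject:
  fixes p p' :: "bool \<times> nat \<times> nat \<times> 'k::field fps \<times> 'k fps \<times> 'k fps"
  assumes "p = (t, i, j, x, y, z)" "x \<in> fps_trunc i" "y \<in> fps_trunc (i + j + of_bool t)" "z \<in> fps_trunc j"
    and "p' = (t', i', j', x', y', z')" "x' \<in> fps_trunc i'" "y' \<in> fps_trunc (i' + j' + of_bool t')" "z' \<in> fps_trunc j'"
    and eq: "lattice_rep p <#\<^bsub>GL\<^esub> GL_O = lattice_rep p' <#\<^bsub>GL\<^esub> GL_O"
  shows "p = p'"
proof -
  obtain k where k: "k \<in> GL_O" "lattice_rep p = lattice_rep p' ** k" using coset_eq_GL_O_D[OF eq] .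
  obtain k' where k': "k' \<in> GL_O" "lattice_rep p' = lattice_rep p ** k'" using coset_eq_GL_O_D[OF eq[symmetric]] .
  note D = lattice_rep_eq_D[OF k(1) k(2)[unfolded assms(1,5)]]
    lattice_rep_eq_D[OF k'(1) k'(2)[unfolded assms(1,5)]]
  obtain K K' where "lattice_basis t' i' j' x' y' z' = lattice_basis t i j x y z ** K"
    "lattice_basis t i j x y z = lattice_basis t' i' j' x' y' z' ** K'"
    using D by (metis order.antisym)
  then show ?thesis using lattice_basis_eq_D[OF assms(2-4) assms(6-8)] assms(1,5) by metis
qed

section \<open>\<open>\<gamma>\<close> as an element of E_3\<close>

definition gamma_E3 :: "nat \<Rightarrow> 'k::field fps \<Rightarrow> 'k fps \<Rightarrow> 'k fls" where
  "gamma_E3 n b c = fls_compose_power (fps_to_fls (fps_X ^ n * b)) 3 * fls_X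
     + fls_compose_power (fps_to_fls (fps_X ^ n * c)) 3 * fls_X ^ 2"

lemma map_gamma_O: "map_matrix fps_to_fls (gamma_O n b c) = E3_mult (gamma_E3 n b c)"
proof (rule E3_mult_eqI)
  let ?b = "fps_to_fls (fps_X ^ n * b)" and ?c = "fps_to_fls (fps_X ^ n * c)"
  have "map_matrix fps_to_fls (gamma_O n b c) = vector [vector [0, ?b, ?c],
      vector [?c * fls_X, 0, ?b], vector [?b * fls_X, ?c * fls_X, 0]]"
    by (simp add: vec_eq_iff forall_3 vector_3 gamma_O_def fls_times_fps_to_fls mult_ac)
  then show "E3_of_vec (map_matrix fps_to_fls (gamma_O n b c) *v v) = gamma_E3 n b c * E3_of_vec v" for v
    unfolding gamma_E3_def by (simp only: E3_of_vec_gamma)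
qed

text \<open>The power of s commutes with \<gamma>, both being multiplications in E_3, and
  cancels.\<close>

lemma lattice_rep_stable_iff:
  fixes b c :: "'k::field fps"
  shows "(\<exists>N\<in>gl_O. map_matrix fps_to_fls (gamma_O n b c) ** lattice_rep (t, i, j, x, y, z) =
      lattice_rep (t, i, j, x, y, z) ** N) \<longleftrightarrow>
    (\<exists>N. gamma_O n b c ** lattice_basis t i j x y z = lattice_basis t i j x y z ** N)"
proof -
  define s :: "'k fls" where "s = fls_X_intpow (- int (2 * i + j + of_bool t))"
  let ?G = "gamma_O n b c" and ?R = "lattice_basis t i j x y z"
  have "s \<noteq> 0" by (simp add: s_def fls_shift_eq0_iff)
  then have cancel: "E3_mult s ** A = E3_mult s ** B \<longleftrightarrow> A = B" for A B :: "'k fls ^3^3"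
    using matrix_inv_mult(2)[OF invertible_E3_mult[of s]] by (metis matrix_mul_assoc matrix_mul_lid)
  have rep: "lattice_rep (t, i, j, x, y, z) = E3_mult s ** map_matrix fps_to_fls ?R"
    by (simp only: lattice_rep_def prod.case s_def)
  have "map_matrix fps_to_fls ?G ** (E3_mult s ** map_matrix fps_to_fls ?R) =
      E3_mult s ** (map_matrix fps_to_fls ?G ** map_matrix fps_to_fls ?R)"
    unfolding map_gamma_O matrix_mul_assoc by (simp only: E3_mult_commute)
  then show ?thesis
    unfolding rep gl_O_def
    by (simp add: cancel map_matrix_inject flip: map_matrix_mult matrix_mul_assoc)
qed

text \<open>Surjectivity is the existence of the reduced form, injectivity its uniqueness; the
  stability criteria become the conditions in \<open>stable_params\<close>.\<close>

lemma springer_fiber0_param: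
  fixes b c :: "'k::field fps"
  assumes b: "b dvd 1"
  shows "bij_betw (\<lambda>p. lattice_rep p <#\<^bsub>GL\<^esub> GL_O) (stable_params n b c)
    (springer_fiber0 (map_matrix fps_to_fls (gamma_O n b c)))"
proof (rule bij_betw_imageI)
  let ?\<gamma> = "map_matrix fps_to_fls (gamma_O n b c)"
  show "inj_on (\<lambda>p. lattice_rep p <#\<^bsub>GL\<^esub> GL_O) (stable_params n b c)"
  proof (rule inj_onI)
    fix p p' :: "bool \<times> nat \<times> nat \<times> 'k fps \<times> 'k fps \<times> 'k fps"
    assume in_params: "p \<in> stable_params n b c" "p' \<in> stable_params n b c"
      and eq: "lattice_rep p <#\<^bsub>GL\<^esub> GL_O = lattice_rep p' <#\<^bsub>GL\<^esub> GL_O"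
    obtain t i j x y z where p: "p = (t, i, j, x, y, z)" by (metis prod.collapse)
    obtain t' i' j' x' y' z' where p': "p' = (t', i', j', x', y', z')" by (metis prod.collapse)
    show "p = p'"
      by (rule lattice_rep_coset_inject[OF p _ _ _ p' _ _ _ eq])
        (use in_params in \<open>simp_all add: stable_params_def p p'\<close>)
  qed
  have stable: "(t, i, j, x, y, z) \<in> stable_params n b c \<longleftrightarrow>
     (x \<in> fps_trunc i \<and> y \<in> fps_trunc (i + j + of_bool t) \<and> z \<in> fps_trunc j \<and>
     (\<exists>N\<in>gl_O. ?\<gamma> ** lattice_rep (t, i, j, x, y, z) = lattice_rep (t, i, j, x, y, z) ** N))" for t i j x y z
    unfolding stable_params_def lattice_rep_stable_iff
    by (cases t) (simp_all add: stable_True_iff[OF b] stable_False_iff[OF b])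
  show "(\<lambda>p. lattice_rep p <#\<^bsub>GL\<^esub> GL_O) ` stable_params n b c = springer_fiber0 ?\<gamma>"
  proof (intro equalityI subsetI)
    fix A assume "A \<in> (\<lambda>p. lattice_rep p <#\<^bsub>GL\<^esub> GL_O) ` stable_params n b c"
    then obtain t i j x y z where "(t, i, j, x, y, z) \<in> stable_params n b c"
      "A = lattice_rep (t, i, j, x, y, z) <#\<^bsub>GL\<^esub> GL_O" by auto
    then show "A \<in> springer_fiber0 ?\<gamma>"
      using lattice_rep_invertible[of "(t, i, j, x, y, z)"] unfolding springer_fiber0_eq stable by auto
  next
    fix A assume "A \<in> springer_fiber0 ?\<gamma>"
    then obtain g where g: "A = g <#\<^bsub>GL\<^esub> GL_O" "invertible g" "\<exists>N\<in>gl_O. ?\<gamma> ** g = g ** N"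
      "fls_subdegree (det g) = 0"
      unfolding springer_fiber0_eq by auto
    obtain t i j x y z k where xyz: "x \<in> fps_trunc i" "y \<in> fps_trunc (i + j + of_bool t)" "z \<in> fps_trunc j"
      and k: "k \<in> GL_O" "g = lattice_rep (t, i, j, x, y, z) ** k"
      using exists_lattice_rep[OF g(2,4)] .
    have "(t, i, j, x, y, z) \<in> stable_params n b c"
      unfolding stable using xyz stable_mult_GL_O[OF k(1) g(3)[unfolded k(2)]] by simp
    then show "A \<in> (\<lambda>p. lattice_rep p <#\<^bsub>GL\<^esub> GL_O) ` stable_params n b c"
      unfolding g(1) k(2) coset_mult_GL_O[OF k(1)] by (rule imageI)
  qed
qed

text \<open>\<gamma> generates E_3 over F, so a matrix commuting with \<gamma> is E_3-linear and
  hence multiplication by the image of 1.\<close>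

lemma centralizer_gamma_O:
  fixes b c :: "'k::field fps"
  assumes b: "b dvd 1"
  shows "centralizer (map_matrix fps_to_fls (gamma_O n b c)) = E3_mult ` {x. x \<noteq> 0}"
proof (intro equalityI subsetI)
  fix t assume "t \<in> E3_mult ` {x :: 'k fls. x \<noteq> 0}"
  then show "t \<in> centralizer (map_matrix fps_to_fls (gamma_O n b c))"
    by (auto simp: centralizer_def carrier_GL invertible_E3_mult map_gamma_O E3_mult_commute)
next
  fix t assume "t \<in> centralizer (map_matrix fps_to_fls (gamma_O n b c))"
  then have inv: "invertible t" and comm: "t ** E3_mult (gamma_E3 n b c) = E3_mult (gamma_E3 n b c) ** t"
    by (simp_all add: centralizer_def carrier_GL map_gamma_O)
  \<comment> \<open>\<open>P y\<close> says that t commutes with multiplication by y; such y form a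
    ring containing F and \<gamma>, and the aim is to find s in it.\<close>
  define P where "P y \<longleftrightarrow> (\<forall>v. E3_of_vec (t *v (E3_mult y *v v)) = y * E3_of_vec (t *v v))" for y
  have split: "E3_mult (x + y) *v v = E3_mult x *v v + E3_mult y *v v"
    "E3_mult (x - y) *v v = E3_mult x *v v - E3_mult y *v v"
    "E3_mult (x * y) *v v = E3_mult x *v (E3_mult y *v v)" for x y and v :: "'k fls ^3"
    by (simp_all add: E3_of_vec_add E3_of_vec_diff E3_of_vec_E3_mult algebra_simps flip: E3_of_vec_inject)
  have P_add: "P (x + y)" and P_diff: "P (x - y)" and P_mult: "P (x * y)" if "P x" "P y" for x y
    using that unfolding P_def split
    by (simp_all add: matrix_vector_right_distrib matrix_vector_mult_diff_distrib
        E3_of_vec_add E3_of_vec_diff algebra_simps)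
  have P_base: "P (fls_compose_power f 3)" for f
  proof -
    have "E3_mult (fls_compose_power f 3) *v v = f *s v" for v :: "'k fls ^3"
      by (simp add: E3_of_vec_E3_mult E3_of_vec_scale flip: E3_of_vec_inject)
    then show ?thesis by (simp add: P_def vector_scalar_commute E3_of_vec_scale)
  qed
  have P_gamma: "P (gamma_E3 n b c)"
    by (simp add: P_def matrix_vector_mul_assoc comm E3_of_vec_E3_mult flip: matrix_vector_mul_assoc)
      (simp add: matrix_vector_mul_assoc comm flip: E3_of_vec_E3_mult)
  define B C where "B = fps_to_fls (fps_X ^ n * b)" and "C = fps_to_fls (fps_X ^ n * c)"
  \<comment> \<open>With \<gamma> = B s + C s^2 and s^3 = \<epsilon>, eliminating s^2 between
    \<gamma> and \<gamma>^2 gives D s = B^2 \<gamma> - C \<gamma>^2 + 2 B C^2 \<epsilon>. D is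
    nonzero because B^3 and C^3 \<epsilon> cannot have equal valuations modulo 3.\<close>
  define D where "D = B ^ 3 - C ^ 3 * fls_X"
  have "B \<noteq> 0" using b by (auto simp: B_def)
  have "D \<noteq> 0"
  proof
    assume "D = 0"
    then have eq: "B ^ 3 = C ^ 3 * fls_X" by (simp add: D_def)
    then have "C \<noteq> 0" using \<open>B \<noteq> 0\<close> by auto
    then have "3 * fls_subdegree B = 3 * fls_subdegree C + 1"
      using arg_cong[OF eq, of fls_subdegree] by (simp add: fls_subdegree_pow)
    then show False by presburger
  qed
  have "fls_compose_power D 3 * fls_X = fls_compose_power (B ^ 2) 3 * gamma_E3 n b c
      - fls_compose_power C 3 * (gamma_E3 n b c * gamma_E3 n b c)
      + fls_compose_power (2 * B * C ^ 2 * fls_X) 3"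
  proof -
    have X: "fls_compose_power fls_X 3 = (fls_X ^ 3 :: 'k fls)"
      by (simp add: fls_X_power_conv_shift_1)
    have two: "fls_compose_power 2 3 = (2 :: 'k fls)"
      using fls_compose_power_add[of "1 :: 'k fls" 1 3] by simp
    show ?thesis
      unfolding gamma_E3_def B_def[symmetric] C_def[symmetric] D_def fls_compose_power_diff
        fls_compose_power_mult X two
      by (simp add: X) algebra
  qed
  moreover have "P (\<dots>)"
    by (intro P_add P_diff P_mult P_base P_gamma)
  ultimately have "P (fls_compose_power D 3 * fls_X)" by (simp only:)
  then have "P (fls_compose_power (inverse D) 3 * (fls_compose_power D 3 * fls_X))"
    by (rule P_mult[OF P_base])
  also have "fls_compose_power (inverse D) 3 * (fls_compose_power D 3 * fls_X) =
      fls_compose_power (inverse D * D) 3 * fls_X"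
    by (simp only: fls_compose_power_mult mult.assoc)
  also have "\<dots> = fls_X" using \<open>D \<noteq> 0\<close> by simp
  finally have P_X: "P fls_X" .
  have P: "P y" for y
  proof -
    obtain v where "y = E3_of_vec v" using surj_E3_of_vec by blast
    then show ?thesis
      unfolding E3_of_vec_def power2_eq_square by (simp add: P_add P_mult P_base P_X)
  qed
  obtain v1 :: "'k fls ^3" where v1: "E3_of_vec v1 = 1" using surj_E3_of_vec by (metis surjD)
  have "t = E3_mult (E3_of_vec (t *v v1))"
  proof (rule E3_mult_eqI)
    fix v
    have "E3_mult (E3_of_vec v) *v v1 = v"
      by (simp add: E3_of_vec_E3_mult v1 flip: E3_of_vec_inject)
    then show "E3_of_vec (t *v v) = E3_of_vec (t *v v1) * E3_of_vec v"
      using P[of "E3_of_vec v"] unfolding P_def by (metis mult.commute)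
  qed
  moreover have "t *v v1 \<noteq> 0"
  proof
    assume "t *v v1 = 0"
    then have "v1 = 0"
      using matrix_inv_mult(2)[OF inv] by (metis matrix_vector_mul_assoc matrix_vector_mul_lid matrix_vector_mult_0_right)
    then show False using v1 by simp
  qed
  ultimately show "t \<in> E3_mult ` {x. x \<noteq> 0}" by auto
qed

section \<open>The orbital integral\<close>

lemma GL_O_coset_cases:
  fixes A B :: "('k::field fls ^3^3) set"
  assumes "A \<in> springer_fiber0 \<gamma>" "B \<in> springer_fiber0 \<gamma>" "h \<in> A" "h \<in> B"
  shows "A = B"
proof -
  have "C = h <#\<^bsub>GL\<^esub> GL_O" if C: "C \<in> springer_fiber0 \<gamma>" "h \<in> C" for C
  proof -
    obtain g where g: "C = g <#\<^bsub>GL\<^esub> GL_O" using C(1) unfolding springer_fiber0_eq by blast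
    then obtain k where "k \<in> GL_O" "h = g ** k" using C(2) by (auto simp: l_coset_GL)
    then show ?thesis using coset_mult_GL_O[of k g] g by simp
  qed
  then show ?thesis using assms by metis
qed

lemma Union_springer_fiber0:
  fixes \<gamma> :: "'k::field fls ^3^3"
  shows "\<Union>(springer_fiber0 \<gamma>) =
    {g. invertible g \<and> (\<exists>N\<in>gl_O. \<gamma> ** g = g ** N) \<and> fls_subdegree (det g) = 0}" (is "_ = ?R")
proof (intro equalityI subsetI)
  fix h assume "h \<in> \<Union>(springer_fiber0 \<gamma>)"
  then obtain g k where g: "invertible g" "\<exists>N\<in>gl_O. \<gamma> ** g = g ** N" "fls_subdegree (det g) = 0"
    and k: "k \<in> GL_O" and h: "h = g ** k"
    unfolding springer_fiber0_eq by (auto simp: l_coset_GL)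
  obtain l where l: "l \<in> GL_O" "k ** l = mat 1" using GL_O_inverse[OF k] by metis
  then have "h ** l = g" by (simp add: h flip: matrix_mul_assoc)
  then have "\<exists>N\<in>gl_O. \<gamma> ** h = h ** N" using stable_mult_GL_O[OF l(1), of \<gamma> h] g(2) by simp
  moreover have "det g \<noteq> 0" using g(1) by (simp add: invertible_det_nz)
  ultimately show "h \<in> ?R"
    using g k det_GL_O[OF k] by (simp add: h invertible_mult GL_O_invertible det_mul)
next
  fix g assume g: "g \<in> ?R"
  then have "g <#\<^bsub>GL\<^esub> GL_O \<in> springer_fiber0 \<gamma>" unfolding springer_fiber0_eq by auto
  moreover have "g \<in> g <#\<^bsub>GL\<^esub> GL_O"
    unfolding l_coset_GL by (rule image_eqI[OF _ mat_1_in_GL_O]) simp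
  ultimately show "g \<in> \<Union>(springer_fiber0 \<gamma>)" by blast
qed

lemma haar_measure_coset:
  assumes "haar_measure G M" "x \<in> carrier G" "emeasure M A = 1"
  shows "x <#\<^bsub>G\<^esub> A \<in> sets M" "emeasure M (x <#\<^bsub>G\<^esub> A) = 1"
proof -
  \<comment> \<open>A set outside the sigma-algebra has \<open>emeasure\<close> 0, so measure 1
    entails measurability.\<close>
  have "A \<in> sets M" using assms(3) by (intro emeasure_neq_0_sets) simp
  then show "emeasure M (x <#\<^bsub>G\<^esub> A) = 1"
    using assms unfolding haar_measure_def by simp
  then show "x <#\<^bsub>G\<^esub> A \<in> sets M" by (intro emeasure_neq_0_sets) simp
qed

lemma haar_measure_space:
  assumes "haar_measure G M"
  shows "space M = carrier G"
proof -
  have "sets M = sets (restrict_space borel (carrier G))"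
    using assms by (simp add: haar_measure_def)
  then have "space M = space (restrict_space borel (carrier G))" by (rule sets_eq_imp_space_eq)
  then show ?thesis by (simp add: space_restrict_space)
qed

text \<open>In Weil's formula for the indicator of \<open>X0\<close>, one side is the volume of
  \<open>X0\<close>, a disjoint union of cosets of volume 1; the other is the volume of the set
  \<open>S\<close> of cosets on which the integrand is 1.\<close>

lemma orbital_integral_eq_card:
  fixes \<gamma> :: "'k::field fls ^3^3"
  assumes dg: "haar_measure GL dg" "emeasure dg GL_O = 1"
    and dt: "haar_measure (GL\<lparr>carrier := centralizer \<gamma>\<rparr>) dt" "emeasure dt E3_units = 1"
    and dm: "quotient_measure GL (centralizer \<gamma>) dg dt dm"
    and T: "centralizer \<gamma> = E3_mult ` {x. x \<noteq> 0}"
    and fin: "finite (springer_fiber0 \<gamma>)"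
  shows "orbital_integral dm \<gamma> = real (card (springer_fiber0 \<gamma>))"
proof -
  define T where "T = centralizer \<gamma>"
  define st where "st g \<longleftrightarrow> (\<exists>N\<in>gl_O. \<gamma> ** g = g ** N)" for g :: "'k fls ^3^3"
  define X0 where "X0 = \<Union>(springer_fiber0 \<gamma>)"
  have X0: "X0 = {g. invertible g \<and> st g \<and> fls_subdegree (det g) = 0}"
    unfolding X0_def st_def by (rule Union_springer_fiber0)
  have T_eq: "T = E3_mult ` {x. x \<noteq> 0}" unfolding T_def by (rule T)
  have T_inv: "invertible t" if "t \<in> T" for t
    using that by (auto simp: T_eq invertible_E3_mult)
  have T_mult: "s ** t \<in> T" if "s \<in> T" "t \<in> T" for s t
    using that by (auto simp: T_eq simp flip: E3_mult_mult)
  have T_inverse: "\<exists>s\<in>T. s ** t = mat 1" if t: "t \<in> T" for t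
  proof -
    obtain x where "t = E3_mult x" "x \<noteq> 0" using t by (auto simp: T_eq)
    then show ?thesis
      by (intro bexI[of _ "E3_mult (inverse x)"]) (auto simp: T_eq simp flip: E3_mult_mult)
  qed
  have st_T1: "st (t ** g)" if "t \<in> T" "st g" for t g
  proof -
    obtain N where N: "N \<in> gl_O" "\<gamma> ** g = g ** N" using \<open>st g\<close> by (auto simp: st_def)
    have "t ** \<gamma> = \<gamma> ** t" using \<open>t \<in> T\<close> by (simp add: T_def centralizer_def)
    then have "\<gamma> ** (t ** g) = t ** g ** N" using N(2) by (metis matrix_mul_assoc)
    then show ?thesis using N(1) by (auto simp: st_def)
  qed
  have st_T: "st (t ** g) \<longleftrightarrow> st g" if "t \<in> T" for t g
    using T_inverse[OF that] st_T1[OF that] st_T1[of _ "t ** g"] by (metis matrix_mul_assoc matrix_mul_lid)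
  have fiber: "\<exists>g. A = g <#\<^bsub>GL\<^esub> GL_O \<and> invertible g" if "A \<in> springer_fiber0 \<gamma>" for A
    using that unfolding springer_fiber0_eq by auto
  have coset_sets: "g <#\<^bsub>GL\<^esub> GL_O \<in> sets dg" "emeasure dg (g <#\<^bsub>GL\<^esub> GL_O) = 1" if "invertible g" for g
    using haar_measure_coset[OF dg(1) _ dg(2), of g] that by (simp_all add: carrier_GL)
  have "springer_fiber0 \<gamma> \<subseteq> sets dg" using fiber coset_sets(1) by blast
  moreover have "disjoint_family_on (\<lambda>A. A) (springer_fiber0 \<gamma>)"
    unfolding disjoint_family_on_def using GL_O_coset_cases by blast
  ultimately have "emeasure dg X0 = (\<Sum>A\<in>springer_fiber0 \<gamma>. emeasure dg A)"
    unfolding X0_def using sum_emeasure[of "\<lambda>A. A" "springer_fiber0 \<gamma>" dg] fin by simp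
  also have "\<dots> = (\<Sum>A\<in>springer_fiber0 \<gamma>. 1)"
    using fiber coset_sets(2) by (intro sum.cong refl) metis
  finally have card_X0: "emeasure dg X0 = of_nat (card (springer_fiber0 \<gamma>))" by simp
  have X0_sets: "X0 \<in> sets dg"
    unfolding X0_def using fin \<open>springer_fiber0 \<gamma> \<subseteq> sets dg\<close> by (intro sets.finite_Union)
  define S where "S = {C \<in> rcosets\<^bsub>GL\<^esub> T. \<exists>g\<in>C. st g}"
  have rcosets: "C \<in> rcosets\<^bsub>GL\<^esub> T \<longleftrightarrow> (\<exists>g. invertible g \<and> C = (\<lambda>t. t ** g) ` T)" for C
    by (auto simp: RCOSETS_def r_coset_def GL_def)
  have one_T: "mat 1 \<in> T" unfolding T_eq by (rule image_eqI[of _ _ 1]) simp_all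
  have U_S: "\<Union>S = {g. invertible g \<and> st g}"
  proof (intro equalityI subsetI)
    fix h assume "h \<in> \<Union>S"
    then obtain g t s where "invertible g" "t \<in> T" "h = t ** g" "s \<in> T" "st (s ** g)"
      unfolding S_def by (auto simp: rcosets)
    then show "h \<in> {g. invertible g \<and> st g}" using st_T T_inv by (auto simp: invertible_mult)
  next
    fix g assume "g \<in> {g. invertible g \<and> st g}"
    moreover have "g \<in> (\<lambda>t. t ** g) ` T" by (rule image_eqI[OF _ one_T]) simp
    ultimately show "g \<in> \<Union>S" unfolding S_def by (auto simp: rcosets)
  qed
  have shift: "\<exists>x :: 'k fls. x \<noteq> 0 \<and> fls_subdegree x = m" for m :: int
    by (rule exI[of _ "fls_X_intpow m :: 'k fls"]) (simp add: fls_shift_eq0_iff)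
  then obtain s :: "int \<Rightarrow> 'k fls" where s: "\<And>m. s m \<noteq> 0" "\<And>m. fls_subdegree (s m) = m" by metis
  have det_s: "det (E3_mult (s m)) \<noteq> 0" "fls_subdegree (det (E3_mult (s m))) = m" for m
    using s[of m] invertible_E3_mult[of "s m"] by (simp_all add: subdegree_det_E3_mult invertible_det_nz)
  \<comment> \<open>A set of cosets is measurable when its union is. The union is written as
    countably many translates of cosets of \<open>GL_O\<close>, where \<open>s m\<close> moves the
    valuation of the determinant from 0 to m.\<close>
  have "\<Union>S = (\<Union>m. \<Union>A\<in>springer_fiber0 \<gamma>. E3_mult (s m) <#\<^bsub>GL\<^esub> A)"
  proof -
    have "g \<in> \<Union>S \<longleftrightarrow> (\<exists>m. \<exists>h\<in>X0. g = E3_mult (s m) ** h)" for g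
    proof
      assume "g \<in> \<Union>S"
      then have g: "invertible g" "st g" by (simp_all add: U_S)
      let ?m = "fls_subdegree (det g)"
      have sT: "E3_mult (s ?m) \<in> T" using s(1) by (auto simp: T_eq)
      obtain t where t: "t \<in> T" "t ** E3_mult (s ?m) = mat 1" using T_inverse[OF sT] by blast
      then have t': "E3_mult (s ?m) ** t = mat 1" by (metis matrix_left_right_inverse)
      have "det (E3_mult (s ?m)) * det t = 1" using arg_cong[OF t', of det] by (simp add: det_mul det_I)
      then have "fls_subdegree (det (E3_mult (s ?m)) * det t) = 0" by simp
      then have "fls_subdegree (det t) = - ?m" using det_s(1)[of ?m] det_s(2)[of ?m] T_inv[OF t(1)]
        by (simp add: invertible_det_nz)
      then have "t ** g \<in> X0"
        using g t(1) T_inv[OF t(1)] st_T unfolding X0 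
        by (simp add: invertible_mult det_mul) (simp add: invertible_det_nz)
      moreover have "g = E3_mult (s ?m) ** (t ** g)" by (simp add: matrix_mul_assoc t')
      ultimately show "\<exists>m. \<exists>h\<in>X0. g = E3_mult (s m) ** h" by blast
    next
      assume "\<exists>m. \<exists>h\<in>X0. g = E3_mult (s m) ** h"
      then show "g \<in> \<Union>S" unfolding U_S X0
        using s(1) st_T1 by (auto simp: T_eq invertible_mult invertible_E3_mult)
    qed
    then show ?thesis unfolding set_eq_iff by (simp add: X0_def l_coset_GL image_iff)
  qed
  moreover have "E3_mult (s m) <#\<^bsub>GL\<^esub> A \<in> sets dg" if A: "A \<in> springer_fiber0 \<gamma>" for m A
  proof -
    obtain g where g: "A = g <#\<^bsub>GL\<^esub> GL_O" "invertible g" using fiber[OF A] by blast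
    have "E3_mult (s m) <#\<^bsub>GL\<^esub> A = (E3_mult (s m) ** g) <#\<^bsub>GL\<^esub> GL_O"
      by (simp add: g l_coset_GL image_image matrix_mul_assoc)
    then show ?thesis using g s(1) by (simp add: coset_sets invertible_mult invertible_E3_mult)
  qed
  ultimately have "\<Union>S \<in> sets dg"
    using fin by (auto intro!: sets.countable_UN sets.finite_UN)
  then have S_sets: "S \<in> sets dm"
    using dm by (auto simp: quotient_measure_def S_def T_def)
  have space_dm: "space dm = rcosets\<^bsub>GL\<^esub> T"
    using dm by (simp add: quotient_measure_def T_def)
  have const: "the_elem (f ` C) = c" if "C \<in> rcosets\<^bsub>GL\<^esub> T" "\<And>g. g \<in> C \<Longrightarrow> f g = c"
    for f :: "'k fls ^3^3 \<Rightarrow> 'b" and C c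
  proof -
    have "C \<noteq> {}" using that(1) one_T by (auto simp: rcosets)
    then have "f ` C = {c}" using that(2) by auto
    then show ?thesis by simp
  qed
  have in_S: "st g \<longleftrightarrow> C \<in> S" "invertible g" if C: "C \<in> rcosets\<^bsub>GL\<^esub> T" "g \<in> C" for C g
  proof -
    show "invertible g" using C T_inv by (auto simp: rcosets invertible_mult)
    show "st g \<longleftrightarrow> C \<in> S"
      using C st_T by (auto simp: S_def rcosets)
  qed
  have inner: "(\<integral>\<^sup>+ t. indicator X0 (t \<otimes>\<^bsub>GL\<^esub> g) \<partial>dt) = (indicator S C :: ennreal)"
    if C: "C \<in> rcosets\<^bsub>GL\<^esub> T" "g \<in> C" for C g
  proof -
    let ?m = "- fls_subdegree (det g)"
    let ?A = "E3_mult (s ?m) <#\<^bsub>GL\<lparr>carrier := T\<rparr>\<^esub> E3_units"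
    have inv: "invertible g" using in_S(2)[OF C] .
    have "E3_mult (s ?m) \<in> T" using s(1) by (auto simp: T_eq)
    then have A: "?A \<in> sets dt" "emeasure dt ?A = 1"
      using haar_measure_coset[OF dt(1) _ dt(2), of "E3_mult (s ?m)"] by (simp_all add: T_def)
    \<comment> \<open>The elements t for which t g has determinant of valuation 0 form a single
      coset of the units, since elements of E_3 of equal valuation differ by a unit.\<close>
    have A_eq: "?A = {t \<in> T. fls_subdegree (det t) = ?m}"
    proof (intro equalityI subsetI)
      fix t assume "t \<in> ?A"
      then obtain u where u: "fps_nth u 0 \<noteq> 0" "t = E3_mult (s ?m * fps_to_fls u)"
        by (auto simp: l_coset_def GL_def E3_units_eq E3_mult_mult)
      then have "u \<noteq> 0" "subdegree u = 0" by auto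
      then show "t \<in> {t \<in> T. fls_subdegree (det t) = ?m}"
        using s[of ?m] by (auto simp: u(2) T_eq subdegree_det_E3_mult fls_subdegree_fls_to_fps)
    next
      fix t assume "t \<in> {t \<in> T. fls_subdegree (det t) = ?m}"
      then obtain x where x: "x \<noteq> 0" "t = E3_mult x" "fls_subdegree x = ?m"
        by (auto simp: T_eq subdegree_det_E3_mult)
      define y where "y = x / s ?m"
      have y: "x = s ?m * y" "y \<noteq> 0" using x(1) s(1)[of ?m] by (auto simp: y_def)
      then have "fls_subdegree y = 0" using x(3) s[of ?m] by simp
      then have "y \<in> range fps_to_fls" 
        unfolding range_fps_to_fls_iff by simp
      then obtain u where u: "y = fps_to_fls u" by blast
      have "subdegree u = 0" "u \<noteq> 0" using \<open>fls_subdegree y = 0\<close> y(2) by (auto simp: u fls_subdegree_fls_to_fps)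
      then have "u dvd 1" by (metis fps_is_unit_iff nth_subdegree_nonzero)
      then show "t \<in> ?A"
        by (auto simp: l_coset_def GL_def E3_units_eq x(2) y(1) u E3_mult_mult)
    qed
    have "t ** g \<in> X0 \<longleftrightarrow> C \<in> S \<and> t \<in> ?A" if "t \<in> T" for t
      using T_inv[OF that] inv that in_S(1)[OF C] st_T[OF that]
      unfolding X0 A_eq by (auto simp: invertible_mult det_mul invertible_det_nz)
    then have "(\<integral>\<^sup>+ t. indicator X0 (t \<otimes>\<^bsub>GL\<^esub> g) \<partial>dt) =
        (\<integral>\<^sup>+ t. (indicator S C :: ennreal) * indicator ?A t \<partial>dt)"
      using haar_measure_space[OF dt(1)]
      by (intro nn_integral_cong) (auto simp: T_def mult_GL indicator_def)
    also have "\<dots> = indicator S C"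
      using A by (simp add: nn_integral_cmult_indicator)
    finally show ?thesis .
  qed
  have "of_nat (card (springer_fiber0 \<gamma>)) = (\<integral>\<^sup>+ g. indicator X0 g \<partial>dg)"
    using X0_sets card_X0 by simp
  also have "\<dots> = (\<integral>\<^sup>+ C. the_elem ((\<lambda>g. \<integral>\<^sup>+ t. indicator X0 (t \<otimes>\<^bsub>GL\<^esub> g) \<partial>dt) ` C) \<partial>dm)"
  proof -
    have "(indicator X0 :: _ \<Rightarrow> ennreal) \<in> borel_measurable dg" using X0_sets by simp
    then show ?thesis using dm unfolding quotient_measure_def by blast
  qed
  also have "\<dots> = (\<integral>\<^sup>+ C. indicator S C \<partial>dm)"
    using inner by (intro nn_integral_cong const) (auto simp: space_dm)
  also have "\<dots> = emeasure dm S" using S_sets by simp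
  finally have card_S: "emeasure dm S = of_nat (card (springer_fiber0 \<gamma>))" by simp
  have "orbital_integral dm \<gamma> = (\<integral>C. indicator S C \<partial>dm)"
    unfolding orbital_integral_def
  proof (intro Bochner_Integration.integral_cong refl const)
    fix C g assume C: "C \<in> space dm" "g \<in> C"
    then have "invertible g" "st g \<longleftrightarrow> C \<in> S" using in_S by (auto simp: space_dm)
    then show "indicator gl_O (Ad (matrix_inv g) \<gamma>) = (indicator S C :: real)"
      by (simp add: Ad_inv_in_gl_O_iff st_def indicator_def)
  qed (simp add: space_dm)
  also have "\<dots> = measure dm S"
    using sets.sets_into_space[OF S_sets] by (simp add: Int_absorb2)
  also have "\<dots> = real (card (springer_fiber0 \<gamma>))"
    by (simp add: measure_def card_S)
  finally show ?thesis .
qed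

section \<open>Evaluation of the count\<close>

lemma sum_int_interval:
  "(\<Sum>i = 1..int n. f i) = (\<Sum>i = 1..n. f (int i))"
  by (rule sum.reindex_bij_witness[of _ int nat]) auto

text \<open>An antidiagonal i + j = s with s <= n has s + 1 points; beyond the main one the point
  reflection (n - i, n - j) leads back to the open triangle i + j < n.\<close>

lemma sum_square_diagonals:
  fixes f :: "nat \<Rightarrow> real"
  shows "(\<Sum>(i, j)\<in>{..n} \<times> {..n}. f (i + j)) =
    (\<Sum>s\<le>n. (real s + 1) * f s) + (\<Sum>l<n. (real l + 1) * f (2 * n - l))"
proof -
  have "{..n} \<times> {..n} = {(i, j). i + j \<le> n} \<union> {(i, j). i \<le> n \<and> j \<le> n \<and> n < i + j}"
    by auto
  then have "(\<Sum>(i, j)\<in>{..n} \<times> {..n}. f (i + j)) =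
      (\<Sum>(i, j)\<in>{(i, j). i + j \<le> n}. f (i + j)) +
      (\<Sum>(i, j)\<in>{(i, j). i \<le> n \<and> j \<le> n \<and> n < i + j}. f (i + j))"
    by (simp only:) (intro sum.union_disjoint; auto intro: finite_subset[of _ "{..n} \<times> {..n}"])
  moreover have "(\<Sum>(i, j)\<in>{(i, j). i + j \<le> n}. f (i + j)) = (\<Sum>s\<le>n. (real s + 1) * f s)"
    by (subst sum.triangle_reindex_eq) (simp add: algebra_simps)
  moreover have "(\<Sum>(i, j)\<in>{(i, j). i \<le> n \<and> j \<le> n \<and> n < i + j}. f (i + j)) =
      (\<Sum>(i, j)\<in>{(i, j). i + j < n}. f (2 * n - (i + j)))"
    by (rule sum.reindex_bij_witness[of _ "\<lambda>(i, j). (n - i, n - j)" "\<lambda>(i, j). (n - i, n - j)"])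
      auto
  moreover have "(\<Sum>(i, j)\<in>{(i, j). i + j < n}. f (2 * n - (i + j))) =
      (\<Sum>l<n. (real l + 1) * f (2 * n - l))"
    by (subst sum.triangle_reindex) (simp add: algebra_simps)
  ultimately show ?thesis by simp
qed

text \<open>The right side collects the antidiagonals i + j <= n of the first type and all of the
  second, up to two boundary terms. As the floor grows by 1 when i grows by 3, the induction raises
  n by 3 and m by 1; the three residues r follow.\<close>

lemma lower_sums:
  fixes q :: real and m r :: nat
  assumes "r < 3" "q \<noteq> 0"
  defines "n \<equiv> 3 * m + r"
  shows "1 + 2 * (\<Sum>i = 1..m. q powi (2 * (3 * int i - 1)) * (q ^ 2 + q + 1))
      + (\<Sum>i = 1..n. (real i - 2 * real (i div 3) - 1) * q powi (2 * int i - 3)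
           * (q ^ 3 + 2 * q ^ 2 + 2 * q + 1)) =
    (\<Sum>s\<le>n. (real s + 1) * q ^ (2 * s)) + (\<Sum>s<n. (real s + 1) * q ^ (2 * s + 1))
      - 2 * (real m + of_bool (0 < r)) * q ^ (2 * n)
      - (real m + of_bool (r = 1)) * q powi (2 * int n - 1)"
proof -
  have div: "Suc (3 * m) div 3 = m" "Suc (Suc (3 * m)) div 3 = m" "Suc (Suc (Suc (3 * m))) div 3 = m + 1"
    for m :: nat
    by presburger+
  have pw: "q powi (2 * int i - 1) = q ^ (2 * i) / q" "q powi (2 * int i - 3) = q ^ (2 * i) / q ^ 3"
     "q powi (2 * (3 * int i - 1)) = q ^ (6 * i) / q ^ 2" for i
    using \<open>q \<noteq> 0\<close> power_int_diff[of q "2 * int i" 1] power_int_diff[of q "2 * int i" 3]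
      power_int_diff[of q "6 * int i" 2] power_int_of_nat[of q "2 * i"] power_int_of_nat[of q "6 * i"]
    by (simp_all add: algebra_simps)
  \<comment> \<open>The two upper limits vary independently in \<open>L\<close>, so a step of the
    induction splits into single increments of n and of m.\<close>
  define L where "L m n = 1 + 2 * (\<Sum>i = 1..m. q powi (2 * (3 * int i - 1)) * (q ^ 2 + q + 1))
      + (\<Sum>i = 1..n. (real i - 2 * real (i div 3) - 1) * q powi (2 * int i - 3)
           * (q ^ 3 + 2 * q ^ 2 + 2 * q + 1)) -
    (\<Sum>s\<le>n. (real s + 1) * q ^ (2 * s)) - (\<Sum>s<n. (real s + 1) * q ^ (2 * s + 1))"
    for m n
  have L_Suc: "L m (Suc n) = L m n + (real n - 2 * real (Suc n div 3)) * (q ^ (2 * n) / q)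
        * (q ^ 3 + 2 * q ^ 2 + 2 * q + 1) - (real n + 2) * (q ^ (2 * n) * q ^ 2) - (real n + 1) * (q ^ (2 * n) * q)"
    for m n
    using pw(2)[of "Suc n"] \<open>q \<noteq> 0\<close>
    by (simp add: L_def power2_eq_square power3_eq_cube mult_ac)
  have L_Suc1: "L (Suc m) n = L m n + 2 * (q ^ (6 * m) * q ^ 4 * (q ^ 2 + q + 1))" for m n
  proof -
    have "q ^ (6 * Suc m) / q ^ 2 = q ^ (6 * m) * q ^ 4"
      using \<open>q \<noteq> 0\<close> power_diff[of q 2 "6 * Suc m"] by (simp add: ac_simps flip: power_add)
    then show ?thesis using pw(3)[of "Suc m"] by (simp add: L_def)
  qed
  \<comment> \<open>With \<open>R m\<close> as the unit of scale, every power that occurs is a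
    polynomial multiple of it and the divisions by q disappear.\<close>
  define R where "R m = q ^ (6 * m) / q" for m
  have R: "q ^ (6 * m) = R m * q" for m using \<open>q \<noteq> 0\<close> by (simp add: R_def)
  have R_Suc: "R (Suc m) = R m * q ^ 6" for m by (simp add: R_def power_add)
  have e: "q ^ (2 * (3 * m)) = R m * q" "q ^ (2 * Suc (3 * m)) = R m * q ^ 3"
     "q ^ (2 * Suc (Suc (3 * m))) = R m * q ^ 5" for m
    using R[of m] by (simp_all add: power_add eval_nat_numeral)
  have e': "R m * q / q = R m" "R m * q ^ 3 / q = R m * q ^ 2" "R m * q ^ 5 / q = R m * q ^ 4" for m
    using \<open>q \<noteq> 0\<close> by (simp_all add: eval_nat_numeral)
  have main: "L m (3 * m) = - 2 * real m * (R m * q) - real m * R m" for m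
  proof (induction m)
    case 0 show ?case by (simp add: L_def)
  next
    case (Suc m)
    have "3 * Suc m = Suc (Suc (Suc (3 * m)))" by simp
    then have "L (Suc m) (3 * Suc m) = L (Suc m) (Suc (Suc (Suc (3 * m))))" by (simp only:)
    also have "\<dots> = - 2 * (real m + 1) * (R (Suc m) * q) - (real m + 1) * R (Suc m)"
      unfolding L_Suc L_Suc1 Suc e e' div R R_Suc of_nat_Suc of_nat_add of_nat_mult
        of_nat_numeral of_nat_1 by algebra
    finally show ?case by (simp add: algebra_simps)
  qed
  consider "r = 0" | "r = 1" | "r = 2" using \<open>r < 3\<close> by linarith
  then have "L m n = - 2 * (real m + of_bool (0 < r)) * q ^ (2 * n)
      - (real m + of_bool (r = 1)) * (q ^ (2 * n) / q)"
  proof cases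
    case 1
    then have "n = 3 * m" by (simp add: n_def)
    then show ?thesis using main[of m] 1 by (simp only: e e') simp
  next
    case 2
    then have n: "n = Suc (3 * m)" by (simp add: n_def)
    have "L m n = - 2 * (real m + 1) * (R m * q ^ 3) - (real m + 1) * (R m * q ^ 2)"
      unfolding n L_Suc main e e' div R of_nat_Suc of_nat_mult of_nat_numeral by algebra
    then show ?thesis using 2 by (simp only: n e e') simp
  next
    case 3
    then have n: "n = Suc (Suc (3 * m))" by (simp add: n_def)
    have "L m n = - 2 * (real m + 1) * (R m * q ^ 5) - real m * (R m * q ^ 4)"
      unfolding n L_Suc main e e' div R of_nat_Suc of_nat_mult of_nat_numeral by algebra
    then show ?thesis using 3 by (simp only: n e e') simp
  qed
  then show ?thesis unfolding L_def pw(1)[of n] by linarith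
qed

text \<open>The antidiagonals beyond the main one, divided by q^(3 n) and written in p = 1 / q, by
  the same induction in steps of three.\<close>

lemma upper_sums:
  fixes p :: real and m r :: nat
  assumes "r < 3"
  defines "n \<equiv> 3 * m + r"
  shows "(\<Sum>j<n. (real j - 2 * real ((j + 2) div 3) + 1) * (p ^ j + 2 * p ^ Suc j))
      + 2 * (\<Sum>j<m + of_bool (r = 2). p ^ (3 * j + 2)) =
    (\<Sum>l<n. (real l + 1) * p ^ l) + 2 * (real m + of_bool (0 < r)) * p ^ n"
proof -
  have div: "(3 * m + 2) div 3 = m" "(Suc (3 * m) + 2) div 3 = m + 1"
      "(Suc (Suc (3 * m)) + 2) div 3 = m + 1" for m :: nat
    by presburger+
  have e: "p ^ (3 * m + 2) = p ^ (3 * m) * p ^ 2" for m by (simp add: power_add power2_eq_square)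
  define L where "L m n = (\<Sum>j<n. (real j - 2 * real ((j + 2) div 3) + 1) * (p ^ j + 2 * p ^ Suc j))
      + 2 * (\<Sum>j<m. p ^ (3 * j + 2)) - (\<Sum>l<n. (real l + 1) * p ^ l)" for m n
  have L_Suc: "L m (Suc n) = L m n + (real n - 2 * real ((n + 2) div 3) + 1) * (p ^ n + 2 * p ^ Suc n)
      - (real n + 1) * p ^ n" for m n
    by (simp add: L_def)
  have L_Suc1: "L (Suc m) n = L m n + 2 * p ^ (3 * m + 2)" for m n
    by (simp add: L_def)
  have main: "L m (3 * m) = 2 * real m * p ^ (3 * m)" for m
  proof (induction m)
    case 0 show ?case by (simp add: L_def)
  next
    case (Suc m)
    have "3 * Suc m = Suc (Suc (Suc (3 * m)))" by simp
    then have "L (Suc m) (3 * Suc m) = L (Suc m) (Suc (Suc (Suc (3 * m))))" by (simp only:)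
    also have "\<dots> = 2 * (real m + 1) * (p ^ (3 * m) * p ^ 3)"
      unfolding L_Suc L_Suc1 Suc div e power_Suc of_nat_Suc of_nat_add of_nat_mult of_nat_numeral
        of_nat_1 by algebra
    finally show ?case by (simp add: power_add)
  qed
  consider "r = 0" | "r = 1" | "r = 2" using \<open>r < 3\<close> by linarith
  then have "L (m + of_bool (r = 2)) n = 2 * (real m + of_bool (0 < r)) * p ^ n"
  proof cases
    case 1 then show ?thesis using main[of m] by (simp add: n_def)
  next
    case 2
    then have n: "n = Suc (3 * m)" by (simp add: n_def)
    have "L m n = 2 * (real m + 1) * (p * p ^ (3 * m))"
      unfolding n L_Suc main div power_Suc of_nat_Suc of_nat_mult of_nat_numeral by algebra
    then show ?thesis using 2 n by simp
  next
    case 3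
    then have n: "n = Suc (Suc (3 * m))" by (simp add: n_def)
    have "L (Suc m) n = 2 * (real m + 1) * (p * (p * p ^ (3 * m)))"
      unfolding n L_Suc L_Suc1 main div e power_Suc of_nat_Suc of_nat_mult of_nat_numeral
        of_nat_add of_nat_1 by algebra
    then show ?thesis using 3 n by simp
  qed
  then show ?thesis by (simp add: L_def)
qed

lemma sum_lattice_types_eq_formula:
  fixes q :: real
  assumes "q > 0"
  shows "(\<Sum>(i, j)\<in>{..n} \<times> {..n}. q ^ min (2 * (i + j)) (i + j + n))
      + (\<Sum>(i, j)\<in>{(i, j). i + j < n}. q ^ (2 * (i + j) + 1)) =
      1 + 2 * (\<Sum>i = 1..\<lfloor>real n / 3\<rfloor>. q powi (2 * (3 * i - 1)) * (q ^ 2 + q + 1))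
      + (\<Sum>i = 1..int n. real_of_int (i - 2 * \<lfloor>real_of_int i / 3\<rfloor> - 1)
           * q powi (2 * i - 3) * (q ^ 3 + 2 * q ^ 2 + 2 * q + 1))
      + (\<Sum>i = int n + 1..2 * int n.
           real_of_int (2 * int n - i - 2 * \<lceil>real_of_int (2 * int n - i) / 3\<rceil> + 1)
           * q powi (i + int n - 1) * (q + 2))
      + q powi (2 * int n - 1)
          * real_of_int (\<lceil>(2 * real n - 1) / 3\<rceil> - \<lfloor>(real n - 2) / 3\<rfloor> - 1)
      + 2 * (\<Sum>i = \<lceil>(2 * real n - 1) / 3\<rceil>..int n - 1. q powi (3 * i + 1))"
    (is "?L1 + ?L2 = 1 + 2 * ?A + ?B + ?C + ?D + 2 * ?E")
proof -
  define m r where "m = n div 3" and "r = n mod 3"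
  have n: "n = 3 * m + r" and r: "r < 3" by (auto simp: m_def r_def)
  have rcases: "r = 0 \<or> r = 1 \<or> r = 2" using r by linarith
  \<comment> \<open>The sums over the higher powers have exponents of the form 3 n - k, so they
    become q^(3 n) times polynomials in p.\<close>
  define p where "p = 1 / q"
  have "q \<noteq> 0" using assms by simp
  have qp: "q powi (3 * int n - int k) = q ^ (3 * n) * p ^ k" for k
    using power_int_diff[of q "3 * int n" "int k"] power_int_of_nat[of q "3 * n"] \<open>q \<noteq> 0\<close>
    by (simp add: p_def power_one_over field_simps)
  have fl: "\<lfloor>real k / 3\<rfloor> = int (k div 3)" for k
    using floor_divide_of_nat_eq[of k 3, where 'a = real] by simp
  have ce: "\<lceil>real k / 3\<rceil> = int ((k + 2) div 3)" for k
  proof (rule ceiling_unique)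
    have "3 * ((k + 2) div 3) < k + 3" "k \<le> 3 * ((k + 2) div 3)" by presburger+
    then show "real_of_int (int ((k + 2) div 3)) - 1 < real k / 3" 
      "real k / 3 \<le> real_of_int (int ((k + 2) div 3))" by linarith+
  qed
  \<comment> \<open>The lower limit of \<open>?E\<close> in closed form: the sum has m terms, and
    one more if r = 2.\<close>
  have bounds: "\<lceil>(2 * real n - 1) / 3\<rceil> = int n - int (m + of_bool (r = 2))"
    by (rule ceiling_unique; use rcases in \<open>auto simp: n field_simps\<close>)
  have bounds': "\<lfloor>(real n - 2) / 3\<rfloor> = int m - of_bool (r < 2)"
    by (rule floor_unique; use rcases in \<open>auto simp: n field_simps\<close>)
  have "?A = (\<Sum>i = 1..m. q powi (2 * (3 * int i - 1)) * (q ^ 2 + q + 1))"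
    unfolding fl m_def[symmetric] by (rule sum_int_interval)
  moreover have "?B = (\<Sum>i = 1..n. (real i - 2 * real (i div 3) - 1) * q powi (2 * int i - 3)
           * (q ^ 3 + 2 * q ^ 2 + 2 * q + 1))"
    by (subst sum_int_interval) (simp add: fl)
  moreover have "?C = (\<Sum>j<n. (real j - 2 * real ((j + 2) div 3) + 1)
      * (q ^ (3 * n) * p ^ Suc j) * (q + 2))"
  proof (rule sum.reindex_bij_witness[of _ "\<lambda>j. 2 * int n - int j" "\<lambda>i. nat (2 * int n - i)"])
    fix i assume i: "i \<in> {int n + 1..2 * int n}"
    then obtain j where j: "2 * int n - i = int j" by (metis atLeastAtMost_iff diff_ge_0_iff_ge zero_le_imp_eq_int)
    have e: "i + int n - 1 = 3 * int n - int (Suc j)" using j by simp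
    show "(real (nat (2 * int n - i)) - 2 * real ((nat (2 * int n - i) + 2) div 3) + 1) *
         (q ^ (3 * n) * p ^ Suc (nat (2 * int n - i))) * (q + 2) =
         real_of_int (2 * int n - i - 2 * \<lceil>real_of_int (2 * int n - i) / 3\<rceil> + 1)
           * q powi (i + int n - 1) * (q + 2)"
      unfolding e qp j by (simp add: ce)
  qed auto
  \<comment> \<open>Since q p = 1, the factor q + 2 turns p^(j + 1) into p^j + 2 p^(j + 1).\<close>
  then have "?C = q ^ (3 * n) * (\<Sum>j<n. (real j - 2 * real ((j + 2) div 3) + 1) * (p ^ j + 2 * p ^ Suc j))"
    using \<open>q \<noteq> 0\<close> by (simp add: sum_distrib_left p_def field_simps)
  moreover have "?E = (\<Sum>j<m + of_bool (r = 2). q ^ (3 * n) * p ^ (3 * j + 2))"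
  proof (rule sum.reindex_bij_witness[of _ "\<lambda>j. int n - 1 - int j" "\<lambda>i. nat (int n - 1 - i)"])
    fix i assume "i \<in> {\<lceil>(2 * real n - 1) / 3\<rceil>..int n - 1}"
    then obtain j where j: "int n - 1 - i = int j" by (metis atLeastAtMost_iff diff_ge_0_iff_ge zero_le_imp_eq_int)
    have e: "3 * i + 1 = 3 * int n - int (3 * j + 2)" using j by simp
    show "q ^ (3 * n) * p ^ (3 * nat (int n - 1 - i) + 2) = q powi (3 * i + 1)"
      unfolding e qp j by simp
  qed (auto simp: bounds)
  then have "?E = q ^ (3 * n) * (\<Sum>j<m + of_bool (r = 2). p ^ (3 * j + 2))"
    by (simp add: sum_distrib_left)
  moreover have "?D = (real m + of_bool (r = 1)) * q powi (2 * int n - 1)"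
    unfolding bounds bounds' using rcases by (auto simp: n)
  moreover have "?L1 = (\<Sum>s\<le>n. (real s + 1) * q ^ (2 * s)) + q ^ (3 * n) * (\<Sum>l<n. (real l + 1) * p ^ l)"
  proof -
    \<comment> \<open>For l < n the antidiagonal 2 n - l lies beyond n, so the minimum is its second
      argument, 3 n - l.\<close>
    have "q ^ min (2 * (2 * n - l)) (2 * n - l + n) = q ^ (3 * n) * p ^ l" if "l < n" for l
      using qp[of l] power_int_of_nat[of q "3 * n - l"] that by (simp add: min_def of_nat_diff)
    moreover have "min (2 * s) (s + n) = 2 * s" if "s \<le> n" for s using that by simp
    ultimately show ?thesis
      using sum_square_diagonals[of "\<lambda>k. q ^ min (2 * k) (k + n)" n]
      by (simp add: sum_distrib_left mult_ac)
  qed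
  moreover have "?L2 = (\<Sum>s<n. (real s + 1) * q ^ (2 * s + 1))"
    by (subst sum.triangle_reindex) (simp add: algebra_simps)
  moreover have "q ^ (3 * n) * (\<Sum>j<n. (real j - 2 * real ((j + 2) div 3) + 1) * (p ^ j + 2 * p ^ Suc j))
      + 2 * (q ^ (3 * n) * (\<Sum>j<m + of_bool (r = 2). p ^ (3 * j + 2))) =
      q ^ (3 * n) * (\<Sum>l<n. (real l + 1) * p ^ l) + 2 * (real m + of_bool (0 < r)) * q ^ (2 * n)"
  proof -
    have "q ^ (3 * n) = q ^ (2 * n) * q ^ n" by (simp flip: power_add)
    then have "q ^ (3 * n) * p ^ n = q ^ (2 * n)"
      using \<open>q \<noteq> 0\<close> by (simp add: p_def power_one_over)
    then show ?thesis
      using arg_cong[OF upper_sums[OF r, where m = m and p = p, folded n], of "\<lambda>x. q ^ (3 * n) * x"]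
      by (simp only: distrib_left mult.left_commute[of "q ^ (3 * n)"])
  qed
  \<comment> \<open>Its two boundary terms are cancelled by that of \<open>upper_sums\<close> and by
    \<open>?D\<close>.\<close>
  moreover note lower_sums[OF r \<open>q \<noteq> 0\<close>, of m, folded n]
  ultimately show ?thesis by linarith
qed

theorem theorem8p1:
  fixes b0 c0 :: "'k::{field,finite} fps"
    and n1 n2 :: nat
    and \<gamma> :: "'k fls ^3^3"
    and dg dt :: "('k fls ^3^3) measure"
    and dg_dt :: "('k fls ^3^3) set measure"
    and q :: real
  assumes "CHAR('k) > 3"
    and "q = real CARD('k)"
    and "b0 dvd 1" and "c0 dvd 1"
    and "n1 \<le> n2"
    and "\<gamma> = map_matrix fps_to_fls (vector
           [vector [0, b0 * fps_X ^ n1, c0 * fps_X ^ n2],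
            vector [c0 * fps_X ^ (n2 + 1), 0, b0 * fps_X ^ n1],
            vector [b0 * fps_X ^ (n1 + 1), c0 * fps_X ^ (n2 + 1), 0]])"
    and "haar_measure GL dg"
    and "emeasure dg GL_O = 1"
    and "haar_measure (GL\<lparr>carrier := centralizer \<gamma>\<rparr>) dt"
    and "emeasure dt E3_units = 1"
    and "quotient_measure GL (centralizer \<gamma>) dg dt dg_dt"
  shows "orbital_integral dg_dt \<gamma> = real (card (springer_fiber0 \<gamma>)) \<and>
    real (card (springer_fiber0 \<gamma>)) =
      1 + 2 * (\<Sum>i = 1..\<lfloor>real n1 / 3\<rfloor>. q powi (2 * (3 * i - 1)) * (q ^ 2 + q + 1))
      + (\<Sum>i = 1..int n1. real_of_int (i - 2 * \<lfloor>real_of_int i / 3\<rfloor> - 1)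
           * q powi (2 * i - 3) * (q ^ 3 + 2 * q ^ 2 + 2 * q + 1))
      + (\<Sum>i = int n1 + 1..2 * int n1.
           real_of_int (2 * int n1 - i - 2 * \<lceil>real_of_int (2 * int n1 - i) / 3\<rceil> + 1)
           * q powi (i + int n1 - 1) * (q + 2))
      + q powi (2 * int n1 - 1)
          * real_of_int (\<lceil>(2 * real n1 - 1) / 3\<rceil> - \<lfloor>(real n1 - 2) / 3\<rfloor> - 1)
      + 2 * (\<Sum>i = \<lceil>(2 * real n1 - 1) / 3\<rceil>..int n1 - 1. q powi (3 * i + 1))"
proof -
  \<comment> \<open>Since n1 <= n2, the surplus power of \<epsilon> can be moved into
    \<open>c\<close>, which gives \<gamma> the shape of \<open>gamma_O\<close> with the single
    exponent n1.\<close>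
  define c where "c = c0 * fps_X ^ (n2 - n1)"
  have "n2 = n1 + (n2 - n1)" using assms(5) by simp
  then have pow: "(fps_X :: 'k fps) ^ n2 = fps_X ^ n1 * fps_X ^ (n2 - n1)"
    by (metis power_add)
  have \<gamma>: "\<gamma> = map_matrix fps_to_fls (gamma_O n1 b0 c)"
    unfolding assms(6) gamma_O_def c_def
    by (simp add: power_add pow mult_ac)
  have bij: "bij_betw (\<lambda>p. lattice_rep p <#\<^bsub>GL\<^esub> GL_O) (stable_params n1 b0 c) (springer_fiber0 \<gamma>)"
    unfolding \<gamma> by (rule springer_fiber0_param[OF assms(3)])
  have fin: "finite (springer_fiber0 \<gamma>)"
    using bij_betw_finite[OF bij] card_stable_params(1)[OF assms(3)] by simp
  have T: "centralizer \<gamma> = E3_mult ` {x. x \<noteq> 0}"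
    unfolding \<gamma> by (rule centralizer_gamma_O[OF assms(3)])
  have "q > 0" using assms(2) by simp
  have "real (card (springer_fiber0 \<gamma>)) =
      (\<Sum>(i, j)\<in>{..n1} \<times> {..n1}. q ^ min (2 * (i + j)) (i + j + n1))
      + (\<Sum>(i, j)\<in>{(i, j). i + j < n1}. q ^ (2 * (i + j) + 1))"
    unfolding bij_betw_same_card[OF bij, symmetric] card_stable_params(2)[OF assms(3)]
    by (simp add: assms(2) case_prod_unfold)
  also note sum_lattice_types_eq_formula[OF \<open>q > 0\<close>]
  finally show ?thesis
    using orbital_integral_eq_card[OF assms(7-11) T fin] by (rule conjI[rotated])
qed

end
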